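(* Let $f\in\mathbb{R}[x]_{2d}$ and $G\in\mathcal{S}^m\mathbb{R}[x]$ with $\deg(G)\le 2d$, and consider $\min f(x)$ s.t. $G(x)\succeq0$, with optimal value $f_{\min}$. Assume $f$ and $-G$ are SOS-convex. Then: (i) $f_{d,mom}=f_{\min}$; moreover, if there exists $u\in\mathbb{R}^n$ with $G(u)\succ0$, then also $f_{d,sos}=f_{\min}$. (ii) If $y^*$ is a minimizer of the $d$th order moment relaxation, then the point $u^*=(y^*_{e_1},\dots,y^*_{e_n})$ is a minimizer of $\min f(x)$ s.t. $G(x)\succeq0$.
   Context: $\mathbb{R}[x]_{2d}$ denotes polynomials in $x=(x_1,\dots,x_n)$ of degree at most $2d$; $e_i$ is the $i$th unit vector in $\mathbb{N}^n$. $f$ is SOS-convex if $\nabla^2 f=P^TP$ for some polynomial matrix $P\in\mathbb{R}[x]^{\ell\times n}$. $-G$ is SOS-convex if for every $\xi\in\mathbb{R}^m$ there is a polynomial matrix $F(x)\in\mathbb{R}[x]^{t\times n}$ (possibly depending on $\xi$) with $-\nabla^2(\xi^TG(x)\xi)=F(x)^TF(x)$. With $\Sigma[x]$ the SOS polynomials, $\mathrm{QM}[G]_{2k}=\{\sigma+\sum_t v_t^TGv_t:\sigma\in\Sigma[x],\ v_t\in\mathbb{R}[x]^m,\ \deg\sigma\le2k,\ \deg(v_t^TGv_t)\le2k\}$, and $f_{k,sos}=\max\{\gamma: f-\gamma\in\mathrm{QM}[G]_{2k}\}$. For $y\in\mathbb{R}^{\mathbb{N}^n_{2k}}$ let $\mathscr{L}_y(\sum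 p_\alpha x^\alpha)=\sum p_\alpha y_\alpha$, $\langle f,y\rangle=\mathscr{L}_y(f)$, $[x]_t$ the vector of monomials of degree $\le t$, moment matrix $M_k[y]=\mathscr{L}_y([x]_k[x]_k^T)$, localizing matrix $L^{(k)}_q[y]=\mathscr{L}_y(q\,[x]_s[x]_s^T)$ with $s=k-\lceil\deg q/2\rceil$, and $L^{(k)}_G[y]=(L^{(k)}_{G_{ij}}[y])_{i,j=1}^m$ (block matrix). The $k$th order moment relaxation is $\min\{\langle f,y\rangle: L_G^{(k)}[y]\succeq0,\ M_k[y]\succeq0,\ y_0=1,\ y\in\mathbb{R}^{\mathbb{N}^n_{2k}}\}$ with optimal value $f_{k,mom}$. *)

theory Defs
  imports "HOL-Analysis.Analysis" "HOL-Library.Poly_Mapping"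
begin

text \<open>Real polynomials in the variables indexed by a finite type 'n (so n = CARD('n)):
  finitely supported maps from exponent vectors to real coefficients.
  Multiplication is the convolution product of HOL-Library.Poly_Mapping.\<close>
type_synonym 'n mpoly = "('n \<Rightarrow>\<^sub>0 nat) \<Rightarrow>\<^sub>0 real"

definition tdeg :: "('n::finite \<Rightarrow>\<^sub>0 nat) \<Rightarrow> nat" where
  "tdeg \<alpha> = (\<Sum>i\<in>UNIV. Poly_Mapping.lookup \<alpha> i)"

definition pdeg :: "'n::finite mpoly \<Rightarrow> nat" where
  "pdeg p = Max (insert 0 (tdeg ` Poly_Mapping.keys p))"

definition const :: "real \<Rightarrow> 'n mpoly" where
  "const c = Poly_Mapping.single 0 c"

definition monom :: "('n \<Rightarrow>\<^sub>0 nat) \<Rightarrow> 'n mpoly" where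
  "monom \<alpha> = Poly_Mapping.single \<alpha> 1"

definition peval :: "'n::finite mpoly \<Rightarrow> ('n \<Rightarrow> real) \<Rightarrow> real" where
  "peval p x = (\<Sum>\<alpha>\<in>Poly_Mapping.keys p. Poly_Mapping.lookup p \<alpha> * (\<Prod>i\<in>UNIV. x i ^ Poly_Mapping.lookup \<alpha> i))"

definition pderiv :: "'n \<Rightarrow> 'n mpoly \<Rightarrow> 'n mpoly" where
  "pderiv i p = Abs_poly_mapping
     (\<lambda>\<alpha>. real (Poly_Mapping.lookup \<alpha> i + 1) * Poly_Mapping.lookup p (\<alpha> + Poly_Mapping.single i 1))"

definition hess :: "'n mpoly \<Rightarrow> 'n \<Rightarrow> 'n \<Rightarrow> 'n mpoly" where
  "hess p i j = pderiv i (pderiv j p)"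

definition sos_convex :: "'n mpoly \<Rightarrow> bool" where
  "sos_convex f \<longleftrightarrow> (\<exists>(l::nat) (P :: nat \<Rightarrow> 'n \<Rightarrow> 'n mpoly).
      \<forall>i j. hess f i j = (\<Sum>k<l. P k i * P k j))"

definition quad_form :: "('m::finite \<Rightarrow> 'm \<Rightarrow> 'n mpoly) \<Rightarrow> ('m \<Rightarrow> real) \<Rightarrow> 'n mpoly" where
  "quad_form G \<xi> = (\<Sum>i\<in>UNIV. \<Sum>j\<in>UNIV. const (\<xi> i * \<xi> j) * G i j)"

definition neg_sos_convex_mat :: "('m::finite \<Rightarrow> 'm \<Rightarrow> 'n mpoly) \<Rightarrow> bool" where
  "neg_sos_convex_mat G \<longleftrightarrow> (\<forall>\<xi>. \<exists>(t::nat) (F :: nat \<Rightarrow> 'n \<Rightarrow> 'n mpoly).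
      \<forall>i j. - hess (quad_form G \<xi>) i j = (\<Sum>k<t. F k i * F k j))"

definition symmetric_mat :: "('m \<Rightarrow> 'm \<Rightarrow> 'a) \<Rightarrow> bool" where
  "symmetric_mat G \<longleftrightarrow> (\<forall>i j. G i j = G j i)"

definition mat_deg :: "('m::finite \<Rightarrow> 'm \<Rightarrow> 'n::finite mpoly) \<Rightarrow> nat" where
  "mat_deg G = Max (range (\<lambda>(i,j). pdeg (G i j)))"

definition psd_on :: "'i set \<Rightarrow> ('i \<Rightarrow> 'i \<Rightarrow> real) \<Rightarrow> bool" where
  "psd_on I M \<longleftrightarrow> (\<forall>c. 0 \<le> (\<Sum>a\<in>I. \<Sum>b\<in>I. c a * c b * M a b))"

definition pd_on :: "'i set \<Rightarrow> ('i \<Rightarrow> 'i \<Rightarrow> real) \<Rightarrow> bool" where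
  "pd_on I M \<longleftrightarrow> (\<forall>c. (\<exists>a\<in>I. c a \<noteq> 0) \<longrightarrow> 0 < (\<Sum>a\<in>I. \<Sum>b\<in>I. c a * c b * M a b))"

definition mat_eval :: "('m \<Rightarrow> 'm \<Rightarrow> 'n::finite mpoly) \<Rightarrow> ('n \<Rightarrow> real) \<Rightarrow> 'm \<Rightarrow> 'm \<Rightarrow> real" where
  "mat_eval G x i j = peval (G i j) x"

definition feasible :: "('m::finite \<Rightarrow> 'm \<Rightarrow> 'n::finite mpoly) \<Rightarrow> ('n \<Rightarrow> real) set" where
  "feasible G = {x. psd_on UNIV (mat_eval G x)}"

definition fmin :: "'n::finite mpoly \<Rightarrow> ('m::finite \<Rightarrow> 'm \<Rightarrow> 'n mpoly) \<Rightarrow> ereal" where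
  "fmin f G = Inf ((\<lambda>x. ereal (peval f x)) ` feasible G)"

definition Ly :: "(('n \<Rightarrow>\<^sub>0 nat) \<Rightarrow> real) \<Rightarrow> 'n mpoly \<Rightarrow> real" where
  "Ly y p = (\<Sum>\<alpha>\<in>Poly_Mapping.keys p. Poly_Mapping.lookup p \<alpha> * y \<alpha>)"

definition mons :: "nat \<Rightarrow> ('n::finite \<Rightarrow>\<^sub>0 nat) set" where
  "mons t = {\<alpha>. tdeg \<alpha> \<le> t}"

definition moment_mat :: "(('n \<Rightarrow>\<^sub>0 nat) \<Rightarrow> real) \<Rightarrow> ('n \<Rightarrow>\<^sub>0 nat) \<Rightarrow> ('n \<Rightarrow>\<^sub>0 nat) \<Rightarrow> real" where
  "moment_mat y \<alpha> \<beta> = Ly y (monom (\<alpha> + \<beta>))"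

text \<open>Block localizing matrix L_G^(k)[y], indexed by pairs (i, alpha) with alpha a monomial of
  degree at most s = k - ceil(deg G / 2).\<close>
definition loc_mat :: "('m \<Rightarrow> 'm \<Rightarrow> 'n mpoly) \<Rightarrow> (('n \<Rightarrow>\<^sub>0 nat) \<Rightarrow> real)
    \<Rightarrow> ('m \<times> ('n \<Rightarrow>\<^sub>0 nat)) \<Rightarrow> ('m \<times> ('n \<Rightarrow>\<^sub>0 nat)) \<Rightarrow> real" where
  "loc_mat G y a b = Ly y (G (fst a) (fst b) * monom (snd a + snd b))"

definition loc_order :: "nat \<Rightarrow> ('m::finite \<Rightarrow> 'm \<Rightarrow> 'n::finite mpoly) \<Rightarrow> nat" where
  "loc_order k G = k - (mat_deg G + 1) div 2"

text \<open>Feasible set of the k-th order moment relaxation; y ranges over R^(N^n_2k)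
  (represented as functions vanishing outside monomials of degree at most 2k).\<close>
definition mom_feasible :: "nat \<Rightarrow> ('m::finite \<Rightarrow> 'm \<Rightarrow> 'n::finite mpoly)
    \<Rightarrow> (('n \<Rightarrow>\<^sub>0 nat) \<Rightarrow> real) set" where
  "mom_feasible k G = {y. (\<forall>\<alpha>. \<alpha> \<notin> mons (2*k) \<longrightarrow> y \<alpha> = 0)
       \<and> psd_on (UNIV \<times> mons (loc_order k G)) (loc_mat G y)
       \<and> psd_on (mons k) (moment_mat y)
       \<and> y 0 = 1}"

definition f_mom :: "nat \<Rightarrow> 'n::finite mpoly \<Rightarrow> ('m::finite \<Rightarrow> 'm \<Rightarrow> 'n mpoly) \<Rightarrow> ereal" where
  "f_mom k f G = Inf ((\<lambda>y. ereal (Ly y f)) ` mom_feasible k G)"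

definition is_sos :: "'n mpoly \<Rightarrow> bool" where
  "is_sos \<sigma> \<longleftrightarrow> (\<exists>qs. \<sigma> = (\<Sum>q\<leftarrow>qs. q * q))"

definition vGv :: "('m::finite \<Rightarrow> 'm \<Rightarrow> 'n mpoly) \<Rightarrow> ('m \<Rightarrow> 'n mpoly) \<Rightarrow> 'n mpoly" where
  "vGv G v = (\<Sum>i\<in>UNIV. \<Sum>j\<in>UNIV. v i * G i j * v j)"

definition in_QM :: "nat \<Rightarrow> ('m::finite \<Rightarrow> 'm \<Rightarrow> 'n::finite mpoly) \<Rightarrow> 'n mpoly \<Rightarrow> bool" where
  "in_QM k G p \<longleftrightarrow> (\<exists>\<sigma> vs. is_sos \<sigma> \<and> pdeg \<sigma> \<le> 2*k
       \<and> (\<forall>v\<in>set vs. pdeg (vGv G v) \<le> 2*k)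
       \<and> p = \<sigma> + (\<Sum>v\<leftarrow>vs. vGv G v))"

definition f_sos :: "nat \<Rightarrow> 'n::finite mpoly \<Rightarrow> ('m::finite \<Rightarrow> 'm \<Rightarrow> 'n mpoly) \<Rightarrow> ereal" where
  "f_sos k f G = Sup {ereal \<gamma> | \<gamma>. in_QM k G (f - const \<gamma>)}"

end

theory Submission
  imports Defs "HOL-Computational_Algebra.Fundamental_Theorem_Algebra"
begin

text \<open>By Taylor's formula with integral remainder, an SOS-convex polynomial minus its linearization at
  any point \<open>u\<close> is a sum of squares. Applying the functional of a feasible \<open>y\<close>, with \<open>u\<close> its vector of
  first moments, gives Jensen's inequality, to \<open>f\<close> as well as to \<open>- \<xi>\<^sup>T G \<xi>\<close> for every \<open>\<xi>\<close>: hence \<open>u\<close> is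
  feasible with value at most that of \<open>y\<close>. Under the Slater condition a separating hyperplane yields
  a psd multiplier \<open>\<Lambda>\<close> such that the SOS-convex polynomial \<open>p = f - \<langle>\<Lambda>, G\<rangle>\<close> is bounded below by the
  optimal value. A convex polynomial that is bounded below attains its minimum, and linearizing \<open>p\<close> at a
  minimizer, where the gradient vanishes, writes \<open>p - min p\<close> as a sum of squares.\<close>

section \<open>Evaluation, derivatives and degrees of polynomials\<close>

text \<open>The Taylor remainder is an integral of squares, whereas a finite sum of squares is
  wanted: expanding the integrand in powers of the segment parameter gives a Gram form in finitely
  many polynomials in \<open>x\<close>, whose weights form a psd matrix. Moreover, the moment matrix
  of order \<open>d\<close> controls squares of polynomials of degree at most \<open>d\<close>, so
  the factors in a sum of squares of degree at most \<open>2 * d\<close> must be shown to obey that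
  bound. Finally, the infimum of \<open>f\<close> over the feasible set need not be attained, so no
  KKT point is available: the multiplier comes from the optimal value alone, and attainment is
  proved for the unconstrained \<open>p\<close> instead. The multiplier vectors are constant, which
  is why order \<open>d\<close> suffices on the sos side.\<close>

lemma poly_mapping_sum_single:
  assumes "finite A" "Poly_Mapping.keys p \<subseteq> A"
  shows "p = (\<Sum>k\<in>A. Poly_Mapping.single k (Poly_Mapping.lookup p k))"
proof (rule poly_mapping_eqI)
  fix k
  have "(\<Sum>j\<in>A. (Poly_Mapping.lookup p j when j = k)) = (if k \<in> A then Poly_Mapping.lookup p k else 0)"
    unfolding when_def using assms(1) by (subst sum.delta) auto
  then show "Poly_Mapping.lookup p k =
      Poly_Mapping.lookup (\<Sum>k\<in>A. Poly_Mapping.single k (Poly_Mapping.lookup p k)) k"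
    using assms(2) by (auto simp: lookup_sum lookup_single in_keys_iff)
qed

lemma poly_mapping_induct [case_names zero single add]:
  fixes p :: "'a \<Rightarrow>\<^sub>0 'b::comm_monoid_add"
  assumes "P 0" "\<And>k c. P (Poly_Mapping.single k c)" "\<And>p q. P p \<Longrightarrow> P q \<Longrightarrow> P (p + q)"
  shows "P p"
proof -
  have "P (\<Sum>k\<in>K. Poly_Mapping.single k (g k))" if "finite K" for K and g
    using that by (induction K) (auto intro: assms)
  from this[of "Poly_Mapping.keys p" "Poly_Mapping.lookup p"] show ?thesis
    using poly_mapping_sum_single[of "Poly_Mapping.keys p" p] by simp
qed

lemma Ly_superset:
  assumes "finite A" "Poly_Mapping.keys p \<subseteq> A"
  shows "Ly y p = (\<Sum>\<alpha>\<in>A. Poly_Mapping.lookup p \<alpha> * y \<alpha>)"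
  unfolding Ly_def using assms by (intro sum.mono_neutral_left) (auto simp: in_keys_iff)

lemma Ly_0 [simp]: "Ly y 0 = 0"
  by (simp add: Ly_def)

lemma Ly_add: "Ly y (p + q) = Ly y p + Ly y q"
proof -
  let ?A = "Poly_Mapping.keys p \<union> Poly_Mapping.keys q"
  have "Ly y (p + q) = (\<Sum>\<alpha>\<in>?A. Poly_Mapping.lookup (p + q) \<alpha> * y \<alpha>)"
    using keys_add[of p q] by (intro Ly_superset) auto
  also have "\<dots> = (\<Sum>\<alpha>\<in>?A. Poly_Mapping.lookup p \<alpha> * y \<alpha>) + (\<Sum>\<alpha>\<in>?A. Poly_Mapping.lookup q \<alpha> * y \<alpha>)"
    by (simp add: lookup_add distrib_right sum.distrib)
  also have "\<dots> = Ly y p + Ly y q"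
    by (intro arg_cong2[where f="(+)"] Ly_superset[symmetric]) auto
  finally show ?thesis .
qed

lemma Ly_single [simp]: "Ly y (Poly_Mapping.single \<alpha> c) = c * y \<alpha>"
  by (simp add: Ly_def)

lemma Ly_uminus: "Ly y (- p) = - Ly y p"
proof -
  have "Ly y (- p) + Ly y p = Ly y (- p + p)" by (simp only: Ly_add)
  then show ?thesis by simp
qed

lemma Ly_diff: "Ly y (p - q) = Ly y p - Ly y q"
  using Ly_add[of y p "- q"] by (simp add: Ly_uminus)

lemma Ly_sum: "Ly y (\<Sum>i\<in>I. p i) = (\<Sum>i\<in>I. Ly y (p i))"
  by (induction I rule: infinite_finite_induct) (auto simp: Ly_add)

lemma Ly_sum_list: "Ly y (\<Sum>q\<leftarrow>qs. p q) = (\<Sum>q\<leftarrow>qs. Ly y (p q))"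
  by (induction qs) (auto simp: Ly_add)

lemma Ly_const [simp]: "Ly y (const c) = c * y 0"
  by (simp add: const_def)

lemma Ly_const_mult: "Ly y (const c * p) = c * Ly y p"
  by (induction p rule: poly_mapping_induct)
     (auto simp: const_def mult_single distrib_left Ly_add)

lemma const_0 [simp]: "const 0 = 0" and const_1 [simp]: "const 1 = 1"
  and const_add: "const (a + b) = const a + const b"
  and const_mult: "const (a * b) = const a * const b"
  by (simp_all add: const_def single_add mult_single)

definition mon :: "('n::finite \<Rightarrow> real) \<Rightarrow> ('n \<Rightarrow>\<^sub>0 nat) \<Rightarrow> real" where
  "mon x \<alpha> = (\<Prod>i\<in>UNIV. x i ^ Poly_Mapping.lookup \<alpha> i)"

text \<open>Evaluation at \<open>x\<close> is the functional whose moments are those of the Dirac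
  measure at \<open>x\<close>; linearity of \<open>peval\<close> is inherited from
  \<open>Ly\<close>.\<close>

lemma peval_eq_Ly: "peval p x = Ly (mon x) p"
  by (simp add: peval_def Ly_def mon_def)

lemma mon_0 [simp]: "mon x 0 = 1"
  by (simp add: mon_def)

lemma mon_add: "mon x (\<alpha> + \<beta>) = mon x \<alpha> * mon x \<beta>"
  by (simp add: mon_def lookup_add power_add prod.distrib)

lemma mon_unit: "mon x (Poly_Mapping.single i (Suc 0)) = x i"
proof -
  have "mon x (Poly_Mapping.single i (Suc 0)) = (\<Prod>j\<in>UNIV. if i = j then x j else 1)"
    unfolding mon_def by (intro prod.cong) (auto simp: lookup_single when_def)
  then show ?thesis by simp
qed

lemma peval_0 [simp]: "peval 0 x = 0"
  and peval_add [simp]: "peval (p + q) x = peval p x + peval q x"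
  and peval_uminus [simp]: "peval (- p) x = - peval p x"
  and peval_diff [simp]: "peval (p - q) x = peval p x - peval q x"
  and peval_sum [simp]: "peval (\<Sum>i\<in>I. g i) x = (\<Sum>i\<in>I. peval (g i) x)"
  and peval_sum_list: "peval (\<Sum>i\<leftarrow>is. h i) x = (\<Sum>i\<leftarrow>is. peval (h i) x)"
  and peval_const [simp]: "peval (const c) x = c"
  and peval_single: "peval (Poly_Mapping.single \<alpha> c) x = c * mon x \<alpha>"
  by (simp_all add: peval_eq_Ly Ly_add Ly_uminus Ly_diff Ly_sum Ly_sum_list)

lemma peval_1 [simp]: "peval 1 x = 1"
  using peval_const[of 1] by simp

lemma peval_mult [simp]: "peval (p * q) x = peval p x * peval q x"
proof (induction p rule: poly_mapping_induct)
  case (single k c)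
  show ?case
    by (induction q rule: poly_mapping_induct)
       (auto simp: mult_single peval_single mon_add distrib_left)
qed (auto simp: distrib_right)

lemma peval_prod [simp]: "peval (\<Prod>i\<in>I. g i) x = (\<Prod>i\<in>I. peval (g i) x)"
  by (induction I rule: infinite_finite_induct) auto

lemma peval_power [simp]: "peval (p ^ n) x = peval p x ^ n"
  by (induction n) auto

text \<open>\<open>Abs_poly_mapping\<close> yields this formula once finite support is known: the
  support lies in the preimage of \<open>keys p\<close> under the injective shift by a unit
  vector.\<close>

lemma lookup_pderiv:
  "Poly_Mapping.lookup (pderiv i p) \<alpha> =
     real (Poly_Mapping.lookup \<alpha> i + 1) * Poly_Mapping.lookup p (\<alpha> + Poly_Mapping.single i 1)"
proof -
  have "finite {\<alpha>. real (Poly_Mapping.lookup \<alpha> i + 1) * Poly_Mapping.lookup p (\<alpha> + Poly_Mapping.single i 1) \<noteq> 0}"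
  proof (rule finite_subset)
    show "{\<alpha>. real (Poly_Mapping.lookup \<alpha> i + 1) * Poly_Mapping.lookup p (\<alpha> + Poly_Mapping.single i 1) \<noteq> 0}
      \<subseteq> (\<lambda>\<alpha>. \<alpha> + Poly_Mapping.single i 1) -` Poly_Mapping.keys p"
      by (auto simp: in_keys_iff)
    show "finite ((\<lambda>\<alpha>. \<alpha> + Poly_Mapping.single i 1) -` Poly_Mapping.keys p)"
      by (intro finite_vimageI) (auto simp: inj_on_def)
  qed
  then show ?thesis unfolding pderiv_def by simp
qed

lemma pderiv_0 [simp]: "pderiv i 0 = 0"
  and pderiv_add: "pderiv i (p + q) = pderiv i p + pderiv i q"
  and pderiv_uminus: "pderiv i (- p) = - pderiv i p"
  by (rule poly_mapping_eqI, simp add: lookup_pderiv lookup_add distrib_left)+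

lemma pderiv_single_0:
  assumes "Poly_Mapping.lookup \<alpha> i = 0"
  shows "pderiv i (Poly_Mapping.single \<alpha> c) = 0"
proof (rule poly_mapping_eqI)
  fix \<beta>
  have "\<alpha> \<noteq> \<beta> + Poly_Mapping.single i 1"
    using assms by (auto simp: lookup_add)
  then show "Poly_Mapping.lookup (pderiv i (Poly_Mapping.single \<alpha> c)) \<beta> = Poly_Mapping.lookup 0 \<beta>"
    by (simp add: lookup_pderiv lookup_single when_def)
qed

lemma pderiv_single_add:
  "pderiv i (Poly_Mapping.single (\<alpha> + Poly_Mapping.single i 1) c) =
     Poly_Mapping.single \<alpha> (real (Poly_Mapping.lookup \<alpha> i + 1) * c)"
  by (rule poly_mapping_eqI) (auto simp: lookup_pderiv lookup_single when_def)

text \<open>The right-hand side has the shape produced by the product rule. For exponent 0 the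
  truncated exponent \<open>0 - 1\<close> is harmless because of the factor 0.\<close>

lemma peval_pderiv_single:
  "peval (pderiv i (Poly_Mapping.single \<alpha> c)) x =
     c * (real (Poly_Mapping.lookup \<alpha> i) * x i ^ (Poly_Mapping.lookup \<alpha> i - 1) *
       (\<Prod>j\<in>UNIV - {i}. x j ^ Poly_Mapping.lookup \<alpha> j))"
proof (cases "Poly_Mapping.lookup \<alpha> i = 0")
  case True
  then show ?thesis by (simp add: pderiv_single_0)
next
  case False
  define \<beta> where "\<beta> = \<alpha> - Poly_Mapping.single i 1"
  have \<alpha>: "\<alpha> = \<beta> + Poly_Mapping.single i 1"
    using False by (intro poly_mapping_eqI) (auto simp: \<beta>_def lookup_add lookup_minus lookup_single when_def)
  have "mon x \<beta> = x i ^ Poly_Mapping.lookup \<beta> i * (\<Prod>j\<in>UNIV - {i}. x j ^ Poly_Mapping.lookup \<beta> j)"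
    unfolding mon_def by (rule prod.remove) auto
  moreover have "(\<Prod>j\<in>UNIV - {i}. x j ^ Poly_Mapping.lookup \<alpha> j) =
      (\<Prod>j\<in>UNIV - {i}. x j ^ Poly_Mapping.lookup \<beta> j)"
    by (intro prod.cong) (auto simp: \<alpha> lookup_add lookup_single when_def)
  ultimately show ?thesis
    by (simp add: \<alpha> pderiv_single_add[simplified] peval_single lookup_add)
qed

text \<open>The bridge from formal partial derivatives to calculus; multivariate differentiation is
  replaced throughout by restriction to a line.\<close>

lemma has_real_derivative_peval_line:
  "((\<lambda>t. peval p (\<lambda>i. u i + t * v i)) has_real_derivative
     (\<Sum>i\<in>UNIV. v i * peval (pderiv i p) (\<lambda>i. u i + t * v i))) (at t)"
proof (induction p rule: poly_mapping_induct)
  case (single \<alpha> c)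
  have "((\<lambda>t. c * (\<Prod>i\<in>UNIV. (u i + t * v i) ^ Poly_Mapping.lookup \<alpha> i)) has_real_derivative
     c * (\<Sum>i\<in>UNIV. (real (Poly_Mapping.lookup \<alpha> i) * (u i + t * v i) ^ (Poly_Mapping.lookup \<alpha> i - 1) * v i)
        * (\<Prod>j\<in>UNIV - {i}. (u j + t * v j) ^ Poly_Mapping.lookup \<alpha> j))) (at t)"
    by (intro DERIV_cmult has_field_derivative_prod) (auto intro!: derivative_eq_intros)
  then show ?case
    by (simp add: peval_single mon_def peval_pderiv_single sum_distrib_left mult_ac)
next
  case (add p q)
  then show ?case by (auto simp: pderiv_add distrib_left sum.distrib intro: DERIV_add)
qed simp

section \<open>Total degree, and polynomials determined by their values\<close>

lemma tdeg_add: "tdeg (\<alpha> + \<beta>) = tdeg \<alpha> + tdeg \<beta>"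
  by (simp add: tdeg_def lookup_add sum.distrib)

lemma tdeg_single: "tdeg (Poly_Mapping.single i n) = n"
  by (simp add: tdeg_def lookup_single when_def)

lemma tdeg_eq_0_iff: "tdeg \<alpha> = 0 \<longleftrightarrow> \<alpha> = 0"
  by (auto simp: tdeg_def intro: poly_mapping_eqI)

lemma pdeg_le_iff: "pdeg p \<le> n \<longleftrightarrow> (\<forall>\<alpha>. Poly_Mapping.lookup p \<alpha> \<noteq> 0 \<longrightarrow> tdeg \<alpha> \<le> n)"
  by (auto simp: pdeg_def in_keys_iff)

lemma pdeg_eq_0_imp_const:
  assumes "pdeg p = 0"
  shows "p = const (Poly_Mapping.lookup p 0)"
proof (rule poly_mapping_eqI)
  fix \<alpha>
  have "Poly_Mapping.lookup p \<alpha> = 0" if "\<alpha> \<noteq> 0"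
    using that assms pdeg_le_iff[of p 0] by (auto simp: tdeg_eq_0_iff)
  then show "Poly_Mapping.lookup p \<alpha> = Poly_Mapping.lookup (const (Poly_Mapping.lookup p 0)) \<alpha>"
    by (auto simp: const_def lookup_single when_def)
qed

lemma pdeg_const [simp]: "pdeg (const c) = 0"
proof -
  have "pdeg (const c) \<le> 0"
    unfolding pdeg_le_iff by (auto simp: const_def lookup_single when_def tdeg_def)
  then show ?thesis by simp
qed

lemma pdeg_0 [simp]: "pdeg 0 = 0"
  using pdeg_const[of 0] by simp

lemma pdeg_add_le: "pdeg p \<le> n \<Longrightarrow> pdeg q \<le> n \<Longrightarrow> pdeg (p + q) \<le> n"
  unfolding pdeg_le_iff lookup_add by (metis add_0)

lemma pdeg_uminus [simp]: "pdeg (- p) = pdeg p"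
  by (simp add: pdeg_def)

lemma pdeg_diff_le: "pdeg p \<le> n \<Longrightarrow> pdeg q \<le> n \<Longrightarrow> pdeg (p - q) \<le> n"
  using pdeg_add_le[of p n "- q"] by simp

lemma pdeg_sum_le: "(\<And>i. i \<in> I \<Longrightarrow> pdeg (p i) \<le> n) \<Longrightarrow> pdeg (\<Sum>i\<in>I. p i) \<le> n"
  by (induction I rule: infinite_finite_induct) (auto intro: pdeg_add_le)

lemma pdeg_sum_list_le: "(\<And>i. i \<in> set is \<Longrightarrow> pdeg (p i) \<le> n) \<Longrightarrow> pdeg (\<Sum>i\<leftarrow>is. p i) \<le> n"
  by (induction "is") (auto intro: pdeg_add_le)

lemma lookup_const_mult:
  "Poly_Mapping.lookup (const c * p) \<alpha> = c * Poly_Mapping.lookup p \<alpha>"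
  by (induction p rule: poly_mapping_induct)
     (auto simp: const_def mult_single lookup_single when_def lookup_add distrib_left)

lemma pdeg_const_mult_le: "pdeg p \<le> n \<Longrightarrow> pdeg (const c * p) \<le> n"
  unfolding pdeg_le_iff by (auto simp: lookup_const_mult)

lemma pdeg_pderiv_le:
  assumes "pdeg p \<le> Suc n"
  shows "pdeg (pderiv i p) \<le> n"
  unfolding pdeg_le_iff
proof safe
  fix \<alpha> assume "Poly_Mapping.lookup (pderiv i p) \<alpha> \<noteq> 0"
  then have "Poly_Mapping.lookup p (\<alpha> + Poly_Mapping.single i 1) \<noteq> 0"
    by (simp add: lookup_pderiv)
  then show "tdeg \<alpha> \<le> n"
    using assms unfolding pdeg_le_iff by (fastforce simp: tdeg_add tdeg_single)
qed

lemma peval_pderiv_eq_0: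
  assumes "\<And>x. peval p x = 0"
  shows "peval (pderiv i p) x = 0"
proof -
  define v :: "'a \<Rightarrow> real" where "v = (\<lambda>j. if j = i then 1 else 0)"
  have "((\<lambda>t. peval p (\<lambda>i. x i + t * v i)) has_real_derivative
     (\<Sum>i\<in>UNIV. v i * peval (pderiv i p) (\<lambda>i. x i + 0 * v i))) (at 0)"
    by (rule has_real_derivative_peval_line)
  moreover have "((\<lambda>t. peval p (\<lambda>i. x i + t * v i)) has_real_derivative 0) (at 0)"
    by (simp add: assms)
  ultimately have "(\<Sum>i\<in>UNIV. v i * peval (pderiv i p) (\<lambda>i. x i + 0 * v i)) = 0"
    by (rule DERIV_unique)
  then show ?thesis by (simp add: v_def if_distrib[of "\<lambda>z. z * _"] cong: if_cong)
qed

text \<open>Induction on a degree bound: the formal partial derivatives also vanish as functions and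
  satisfy a smaller bound, hence are zero; in characteristic 0 this kills every nonconstant
  coefficient. Polynomial identities can then be checked pointwise.\<close>

lemma peval_eq_0_imp_eq_0:
  assumes "\<And>x. peval p x = 0"
  shows "p = 0"
proof -
  have "pdeg p \<le> n \<Longrightarrow> (\<And>x. peval p x = 0) \<Longrightarrow> p = 0" for n
  proof (induction n arbitrary: p)
    case 0
    then have "p = const (Poly_Mapping.lookup p 0)" by (intro pdeg_eq_0_imp_const) simp
    with "0.prems"(2)[of undefined] show ?case by (metis peval_const const_0)
  next
    case (Suc n)
    have D: "pderiv i p = 0" for i
      by (intro Suc.IH pdeg_pderiv_le Suc.prems peval_pderiv_eq_0)
    have "Poly_Mapping.lookup p \<alpha> = 0" if "\<alpha> \<noteq> 0" for \<alpha>
    proof -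
      from that obtain i where i: "Poly_Mapping.lookup \<alpha> i \<noteq> 0"
        by (metis lookup_zero poly_mapping_eqI)
      then have "\<alpha> = (\<alpha> - Poly_Mapping.single i 1) + Poly_Mapping.single i 1"
        by (intro poly_mapping_eqI) (auto simp: lookup_add lookup_minus lookup_single when_def)
      then show ?thesis
        using D[of i] lookup_pderiv[of i p "\<alpha> - Poly_Mapping.single i 1"] by simp
    qed
    then have "pdeg p \<le> 0" unfolding pdeg_le_iff by (auto simp: tdeg_eq_0_iff)
    then have "p = const (Poly_Mapping.lookup p 0)" by (intro pdeg_eq_0_imp_const) simp
    with Suc.prems(2)[of undefined] show ?case by (metis peval_const const_0)
  qed
  with assms show ?thesis by blast
qed

lemma peval_eqI: "(\<And>x. peval p x = peval q x) \<Longrightarrow> p = q"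
  using peval_eq_0_imp_eq_0[of "p - q"] by simp

section \<open>Sums of squares\<close>

text \<open>At the vector with entries \<open>t\<close> at \<open>a\<close> and 1 at
  \<open>b\<close> the form is \<open>2 * t * w a b + w b b\<close>; an affine function of
  \<open>t\<close> that is nonnegative everywhere has slope zero.\<close>

lemma psd_on_zero_diag:
  assumes "finite I" "psd_on I w" "\<And>a b. a \<in> I \<Longrightarrow> b \<in> I \<Longrightarrow> w a b = w b a"
    and "a \<in> I" "b \<in> I" "w a a = 0"
  shows "w a b = 0"
proof (cases "a = b")
  case False
  have *: "0 \<le> 2 * t * w a b + w b b" for t
  proof -
    define c where "c = (\<lambda>i. if i = a then t else if i = b then 1 else 0)"
    have sub: "(\<Sum>i\<in>I. c i * g i) = t * g a + g b" for g
    proof -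
      have "(\<Sum>i\<in>I. c i * g i) = (\<Sum>i\<in>{a, b}. c i * g i)"
        using assms by (intro sum.mono_neutral_right) (auto simp: c_def)
      then show ?thesis using False by (simp add: c_def)
    qed
    have "0 \<le> (\<Sum>i\<in>I. \<Sum>j\<in>I. c i * c j * w i j)"
      using assms(2) unfolding psd_on_def by blast
    also have "\<dots> = (\<Sum>i\<in>I. c i * (\<Sum>j\<in>I. c j * w i j))"
      by (simp add: sum_distrib_left mult_ac)
    also have "\<dots> = t * (t * w a a + w a b) + (t * w b a + w b b)"
      by (simp only: sub)
    also have "\<dots> = 2 * t * w a b + w b b"
      using assms(3)[of a b] assms(4-6) by simp
    finally show ?thesis .
  qed
  show ?thesis
  proof (rule ccontr)
    assume "w a b \<noteq> 0"
    then have "2 * (- (w b b + 1) / (2 * w a b)) * w a b = - (w b b + 1)" by simp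
    with *[of "- (w b b + 1) / (2 * w a b)"] show False by linarith
  qed
qed (use assms in simp)

text \<open>Cholesky elimination, one index per induction step: row \<open>a\<close> is split off as
  a rank-one term. The list of vectors stands for the rows of a factor.\<close>

lemma psd_on_imp_sum_squares:
  assumes "finite I" "psd_on I w" "\<And>a b. a \<in> I \<Longrightarrow> b \<in> I \<Longrightarrow> w a b = w b a"
  shows "\<exists>vs :: ('i \<Rightarrow> real) list. \<forall>a\<in>I. \<forall>b\<in>I. w a b = (\<Sum>v\<leftarrow>vs. v a * v b)"
  using assms
proof (induction I arbitrary: w)
  case (insert a I)
  note psd = insert.prems(1) and sym = insert.prems(2)
  have diag: "0 \<le> w a a"
  proof -
    define c where "c = (\<lambda>i. if i = a then 1 else 0 :: real)"
    have sub: "(\<Sum>i\<in>insert a I. c i * g i) = g a" for g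
    proof -
      have "(\<Sum>i\<in>insert a I. c i * g i) = (\<Sum>i\<in>{a}. c i * g i)"
        using insert.hyps by (intro sum.mono_neutral_right) (auto simp: c_def)
      then show ?thesis by (simp add: c_def)
    qed
    have "0 \<le> (\<Sum>i\<in>insert a I. \<Sum>j\<in>insert a I. c i * c j * w i j)"
      using psd unfolding psd_on_def by blast
    also have "\<dots> = (\<Sum>i\<in>insert a I. c i * (\<Sum>j\<in>insert a I. c j * w i j))"
      by (simp only: sum_distrib_left mult.assoc)
    also have "\<dots> = w a a"
      by (simp only: sub)
    finally show ?thesis .
  qed
  \<comment> \<open>Schur complement; if \<open>w a a = 0\<close> the correction vanishes, since \<open>x / 0 = 0\<close>.\<close>
  define w' where "w' = (\<lambda>b c. w b c - w a b * w a c / w a a)"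
  have "psd_on I w'"
    unfolding psd_on_def
  proof
    fix c :: "'i \<Rightarrow> real"
    define s where "s = (\<Sum>b\<in>I. c b * w a b)"
    \<comment> \<open>For \<open>w a a > 0\<close> this value at \<open>a\<close> minimizes the form
      with the other coordinates fixed, and the minimum is the form of the Schur complement at
      \<open>c\<close>.\<close>
    define c' where "c' = c(a := - s / w a a)"
    have c'I: "c' b = c b" if "b \<in> I" for b
      using that insert.hyps by (auto simp: c'_def)
    have "0 \<le> (\<Sum>i\<in>insert a I. \<Sum>j\<in>insert a I. c' i * c' j * w i j)"
      using psd unfolding psd_on_def by blast
    also have "\<dots> = c' a * c' a * w a a + (\<Sum>j\<in>I. c' a * c' j * w a j) +
        ((\<Sum>i\<in>I. c' i * c' a * w i a) + (\<Sum>i\<in>I. \<Sum>j\<in>I. c' i * c' j * w i j))"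
      using insert.hyps by (simp add: sum.distrib)
    also have "(\<Sum>j\<in>I. c' a * c' j * w a j) = c' a * s"
      by (simp add: s_def sum_distrib_left c'I mult_ac)
    also have "(\<Sum>i\<in>I. c' i * c' a * w i a) = c' a * s"
      using sym by (auto simp: s_def sum_distrib_left c'I mult_ac intro!: sum.cong)
    also have "(\<Sum>i\<in>I. \<Sum>j\<in>I. c' i * c' j * w i j) = (\<Sum>i\<in>I. \<Sum>j\<in>I. c i * c j * w i j)"
      by (simp add: c'I)
    also have "c' a * c' a * w a a + c' a * s + (c' a * s + (\<Sum>i\<in>I. \<Sum>j\<in>I. c i * c j * w i j)) =
        (\<Sum>i\<in>I. \<Sum>j\<in>I. c i * c j * w i j) - s * s / w a a"
      by (simp add: c'_def field_simps)
    also have "s * s = (\<Sum>i\<in>I. \<Sum>j\<in>I. c i * c j * (w a i * w a j))"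
      unfolding s_def sum_product by (simp add: mult_ac)
    also have "(\<Sum>i\<in>I. \<Sum>j\<in>I. c i * c j * w i j) - \<dots> / w a a =
        (\<Sum>i\<in>I. \<Sum>j\<in>I. c i * c j * w' i j)"
      by (simp add: w'_def sum_divide_distrib right_diff_distrib sum_subtractf)
    finally show "0 \<le> (\<Sum>i\<in>I. \<Sum>j\<in>I. c i * c j * w' i j)" .
  qed
  moreover have "w' b c = w' c b" if "b \<in> I" "c \<in> I" for b c
    using that sym by (auto simp: w'_def)
  ultimately obtain vs where vs: "w' b c = (\<Sum>v\<leftarrow>vs. v b * v c)" if "b \<in> I" "c \<in> I" for b c
    using insert.IH[of w'] by blast
  \<comment> \<open>The inductive vectors are arbitrary at \<open>a\<close>, so they are reset to 0
    there, and the first vector alone produces row \<open>a\<close>. If \<open>w a a = 0\<close>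
    that vector is 0, matching the vanishing row.\<close>
  define us where "us = (\<lambda>b. w a b / sqrt (w a a)) # map (\<lambda>v. v(a := 0)) vs"
  have row: "w a b = 0" if "w a a = 0" "b \<in> insert a I" for b
    using psd_on_zero_diag[OF _ psd sym] insert.hyps that by blast
  have "w b c = (\<Sum>v\<leftarrow>us. v b * v c)" if bc: "b \<in> insert a I" "c \<in> insert a I" for b c
  proof -
    have sq: "w a b / sqrt (w a a) * (w a c / sqrt (w a a)) = w a b * w a c / w a a" for b c
      using diag by (simp add: real_sqrt_mult[symmetric])
    have zero: "(\<Sum>v\<leftarrow>vs. (v(a := 0)) b * (v(a := 0)) c) = 0" if "b = a \<or> c = a"
      using that by (auto intro!: sum_list_0)
    consider "b = a" | "c = a" | "b \<noteq> a" "c \<noteq> a" by blast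
    then show ?thesis
    proof cases
      case 1
      then show ?thesis using zero sq row bc diag
        by (cases "w a a = 0") (auto simp: us_def o_def)
    next
      case 2
      then show ?thesis using zero sq row bc diag sym[of b a]
        by (cases "w a a = 0") (auto simp: us_def o_def)
    next
      case 3
      then have "w b c = w' b c + w a b * w a c / w a a" "b \<in> I" "c \<in> I"
        using bc by (auto simp: w'_def)
      then show ?thesis using 3 vs sq diag by (simp add: us_def o_def)
    qed
  qed
  then show ?case by blast
qed simp

lemma is_sos_0 [simp]: "is_sos 0"
  unfolding is_sos_def by (rule exI[of _ "[]"]) simp

lemma is_sos_square: "is_sos (q * q)"
  unfolding is_sos_def by (rule exI[of _ "[q]"]) simp

lemma is_sos_add: "is_sos p \<Longrightarrow> is_sos q \<Longrightarrow> is_sos (p + q)"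
  unfolding is_sos_def
proof (elim exE)
  fix ps qs assume "p = (\<Sum>q\<leftarrow>ps. q * q)" "q = (\<Sum>q\<leftarrow>qs. q * q)"
  then show "\<exists>qs. p + q = (\<Sum>q\<leftarrow>qs. q * q)"
    by (intro exI[of _ "ps @ qs"]) simp
qed

lemma is_sos_sum: "(\<And>i. i \<in> I \<Longrightarrow> is_sos (p i)) \<Longrightarrow> is_sos (\<Sum>i\<in>I. p i)"
  by (induction I rule: infinite_finite_induct) (auto intro: is_sos_add)

lemma is_sos_const: "0 \<le> c \<Longrightarrow> is_sos (const c)"
  using is_sos_square[of "const (sqrt c)"] by (simp add: const_mult[symmetric])

lemma peval_is_sos_nonneg: "is_sos p \<Longrightarrow> 0 \<le> peval p x"
  unfolding is_sos_def by (auto simp: peval_sum_list intro!: sum_list_nonneg)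

text \<open>Gram matrix argument: writing \<open>w a b\<close> as a sum of products
  \<open>v a * v b\<close> turns the form into a sum of squares of linear combinations of the
  \<open>q a\<close>.\<close>

lemma is_sos_psd_form:
  fixes q :: "'i \<Rightarrow> 'n mpoly"
  assumes "finite I" "psd_on I w" "\<And>a b. a \<in> I \<Longrightarrow> b \<in> I \<Longrightarrow> w a b = w b a"
  shows "is_sos (\<Sum>a\<in>I. \<Sum>b\<in>I. const (w a b) * (q a * q b))"
proof -
  obtain vs where vs: "w a b = (\<Sum>v\<leftarrow>vs. v a * v b)" if "a \<in> I" "b \<in> I" for a b
    using psd_on_imp_sum_squares[OF assms] by blast
  have "(\<Sum>a\<in>I. \<Sum>b\<in>I. const (\<Sum>v\<leftarrow>us. v a * v b) * (q a * q b)) =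
      (\<Sum>v\<leftarrow>us. (\<Sum>a\<in>I. const (v a) * q a) * (\<Sum>a\<in>I. const (v a) * q a))" for us :: "('i \<Rightarrow> real) list"
    by (induction us)
       (auto simp: const_add const_mult distrib_right distrib_left sum.distrib sum_product mult_ac)
  then have "(\<Sum>a\<in>I. \<Sum>b\<in>I. const (w a b) * (q a * q b)) =
      (\<Sum>p\<leftarrow>map (\<lambda>v. \<Sum>a\<in>I. const (v a) * q a) vs. p * p)"
    by (simp add: vs o_def)
  then show ?thesis unfolding is_sos_def by blast
qed

section \<open>Second-order Taylor expansion and its sum-of-squares remainder\<close>

lemma DERIV_power_Suc: "((\<lambda>s. s ^ Suc n) has_real_derivative real (Suc n) * s ^ n) (at s)"
  using DERIV_pow[of "Suc n" s] by simp

text \<open>First and second antiderivatives of a sum of powers, both vanishing at 0. Exponents may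
  repeat, since they will be sums \<open>a + b\<close> arising from products of
  coefficients.\<close>

lemma DERIV_power_sum:
  fixes a :: "'i \<Rightarrow> real"
  shows "((\<lambda>s. \<Sum>j\<in>J. a j / (real (e j) + 1) * s ^ Suc (e j)) has_real_derivative
      (\<Sum>j\<in>J. a j * s ^ e j)) (at s)" (is ?A)
    and "((\<lambda>s. \<Sum>j\<in>J. a j / ((real (e j) + 1) * (real (e j) + 2)) * s ^ Suc (Suc (e j)))
      has_real_derivative (\<Sum>j\<in>J. a j / (real (e j) + 1) * s ^ Suc (e j))) (at s)" (is ?B)
proof -
  have "((\<lambda>s. \<Sum>j\<in>J. a j / (real (e j) + 1) * s ^ Suc (e j)) has_real_derivative
      (\<Sum>j\<in>J. a j / (real (e j) + 1) * (real (Suc (e j)) * s ^ e j))) (at s)"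
    by (intro DERIV_sum DERIV_cmult DERIV_power_Suc)
  also have "(\<Sum>j\<in>J. a j / (real (e j) + 1) * (real (Suc (e j)) * s ^ e j)) = (\<Sum>j\<in>J. a j * s ^ e j)"
    by (intro sum.cong) (auto simp: field_simps)
  finally show ?A .
  have "((\<lambda>s. \<Sum>j\<in>J. a j / ((real (e j) + 1) * (real (e j) + 2)) * s ^ Suc (Suc (e j)))
      has_real_derivative
      (\<Sum>j\<in>J. a j / ((real (e j) + 1) * (real (e j) + 2)) * (real (Suc (Suc (e j))) * s ^ Suc (e j)))) (at s)"
    by (intro DERIV_sum DERIV_cmult DERIV_power_Suc)
  also have "(\<Sum>j\<in>J. a j / ((real (e j) + 1) * (real (e j) + 2)) * (real (Suc (Suc (e j))) * s ^ Suc (e j))) =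
      (\<Sum>j\<in>J. a j / (real (e j) + 1) * s ^ Suc (e j))"
  proof (intro sum.cong refl)
    fix j
    have "A / (p * q) * (q * z) = A / p * z" if "q \<noteq> 0" for A p q z :: real
      using that by simp
    from this[of "real (e j) + 2"] show "a j / ((real (e j) + 1) * (real (e j) + 2)) * (real (Suc (Suc (e j))) * s ^ Suc (e j)) =
      a j / (real (e j) + 1) * s ^ Suc (e j)" by (simp add: add_ac)
  qed
  finally show ?B .
qed

text \<open>The last sum is the integral remainder: \<open>1 / ((e + 1) * (e + 2))\<close> is the
  integral of \<open>(1 - s) * s ^ e\<close> over the unit interval. Subtracting explicit
  antiderivatives leaves functions with zero derivative, so no integral has to be formed.\<close>

lemma taylor_power_sum:
  fixes g g1 :: "real \<Rightarrow> real"
  assumes g: "\<And>s. (g has_real_derivative g1 s) (at s)"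
    and g1: "\<And>s. (g1 has_real_derivative (\<Sum>j\<in>J. a j * s ^ e j)) (at s)"
  shows "g 1 = g 0 + g1 0 + (\<Sum>j\<in>J. a j / ((real (e j) + 1) * (real (e j) + 2)))"
proof -
  define h1 where "h1 = (\<lambda>s. \<Sum>j\<in>J. a j / (real (e j) + 1) * s ^ Suc (e j))"
  define h where "h = (\<lambda>s. \<Sum>j\<in>J. a j / ((real (e j) + 1) * (real (e j) + 2)) * s ^ Suc (Suc (e j)))"
  have h1: "(h1 has_real_derivative (\<Sum>j\<in>J. a j * s ^ e j)) (at s)"
    and h: "(h has_real_derivative h1 s) (at s)" for s
    using DERIV_power_sum[where J = J and a = a and e = e] unfolding h1_def h_def by blast+
  have "((\<lambda>s. g1 s - h1 s) has_real_derivative 0) (at s)" for s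
    using DERIV_diff[OF g1 h1] by simp
  then have "g1 s - h1 s = g1 0 - h1 0" for s
    using DERIV_isconst_all[of "\<lambda>s. g1 s - h1 s" s 0] by blast
  moreover have "h1 0 = 0" by (simp add: h1_def)
  ultimately have g1_eq: "g1 s = h1 s + g1 0" for s
    by (metis diff_zero add.commute diff_add_cancel)
  have "((\<lambda>s. g s - (h s + g1 0 * s)) has_real_derivative g1 s - (h1 s + g1 0)) (at s)" for s
    by (intro DERIV_diff DERIV_add DERIV_cmult_Id g h)
  then have "((\<lambda>s. g s - (h s + g1 0 * s)) has_real_derivative 0) (at s)" for s
    by (simp add: g1_eq[symmetric])
  then have "g 1 - (h 1 + g1 0 * 1) = g 0 - (h 0 + g1 0 * 0)"
    using DERIV_isconst_all[of "\<lambda>s. g s - (h s + g1 0 * s)" 1 0] by blast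
  then show ?thesis by (simp add: h_def)
qed

text \<open>The entries are the integrals of \<open>(1 - s) * s ^ (a + b)\<close> over the unit interval.\<close>

lemma psd_on_taylor_weights:
  "psd_on {..n} (\<lambda>a b. 1 / ((real (a + b) + 1) * (real (a + b) + 2)))"
  unfolding psd_on_def
proof
  fix c :: "nat \<Rightarrow> real"
  define J where "J = {..n} \<times> {..n}"
  define w where "w = (\<lambda>(a, b). c a * c b)"
  define e where "e = (\<lambda>(a, b). a + b :: nat)"
  \<comment> \<open>\<open>g\<close> is the double antiderivative of the square of
    \<open>\<Sum>a\<le>n. c a * s ^ a\<close>, and \<open>g 1\<close> is the quadratic form at
    \<open>c\<close>; integrating twice from 0 preserves nonnegativity.\<close>
  define g1 where "g1 = (\<lambda>s. \<Sum>j\<in>J. w j / (real (e j) + 1) * s ^ Suc (e j))"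
  define g where "g = (\<lambda>s. \<Sum>j\<in>J. w j / ((real (e j) + 1) * (real (e j) + 2)) * s ^ Suc (Suc (e j)))"
  have g1: "(g1 has_real_derivative (\<Sum>j\<in>J. w j * s ^ e j)) (at s)"
    and g: "(g has_real_derivative g1 s) (at s)" for s
    using DERIV_power_sum[where J = J and a = w and e = e] unfolding g1_def g_def by blast+
  have nonneg: "0 \<le> (\<Sum>j\<in>J. w j * s ^ e j)" for s
  proof -
    have "(\<Sum>j\<in>J. w j * s ^ e j) = (\<Sum>a\<le>n. c a * s ^ a) ^ 2"
      by (simp add: J_def w_def e_def sum.cartesian_product power2_eq_square sum_product
        power_add mult_ac split_def)
    then show ?thesis by simp
  qed
  have g1_nonneg: "0 \<le> g1 s" if "0 \<le> s" for s
  proof -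
    have "g1 0 \<le> g1 s"
    proof (rule DERIV_nonneg_imp_nondecreasing[OF that])
      show "\<exists>y. (g1 has_real_derivative y) (at r) \<and> 0 \<le> y" for r
        using g1[of r] nonneg[of r] by (intro exI conjI)
    qed
    then show ?thesis by (simp add: g1_def)
  qed
  have "g 0 \<le> g 1"
  proof (rule DERIV_nonneg_imp_nondecreasing[of 0 1 g])
    show "\<exists>y. (g has_real_derivative y) (at r) \<and> 0 \<le> y" if "0 \<le> r" for r
      using g[of r] g1_nonneg[OF that] by (intro exI conjI)
  qed simp
  then show "0 \<le> (\<Sum>a\<in>{..n}. \<Sum>b\<in>{..n}. c a * c b * (1 / ((real (a + b) + 1) * (real (a + b) + 2))))"
    by (simp add: g_def J_def w_def e_def sum.cartesian_product split_def)
qed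

abbreviation var :: "'n \<Rightarrow> 'n mpoly" where
  "var i \<equiv> monom (Poly_Mapping.single i 1)"

lemma peval_var [simp]: "peval (var i) x = x i"
  by (simp add: monom_def peval_single mon_unit)

text \<open>The polynomial \<open>p (u + s * (x - u))\<close>, as a univariate polynomial in \<open>s\<close> with coefficients in
  the polynomials in \<open>x\<close>.\<close>

definition line_poly :: "('n::finite \<Rightarrow> real) \<Rightarrow> 'n mpoly \<Rightarrow> 'n mpoly poly" where
  "line_poly u p = (\<Sum>\<alpha>\<in>Poly_Mapping.keys p. [:const (Poly_Mapping.lookup p \<alpha>):] *
     (\<Prod>i\<in>UNIV. [:const (u i), var i - const (u i):] ^ Poly_Mapping.lookup \<alpha> i))"

lemma peval_line_poly:
  "peval (poly (line_poly u p) (const s)) x = peval p (\<lambda>i. u i + s * (x i - u i))"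
  by (simp add: line_poly_def poly_sum poly_prod peval_def[of p] del: One_nat_def)

definition linearization :: "'n::finite mpoly \<Rightarrow> ('n \<Rightarrow> real) \<Rightarrow> 'n mpoly" where
  "linearization f u = const (peval f u) + (\<Sum>i\<in>UNIV. const (peval (pderiv i f) u) * (var i - const (u i)))"

lemma peval_linearization:
  "peval (linearization f u) x = peval f u + (\<Sum>i\<in>UNIV. peval (pderiv i f) u * (x i - u i))"
  by (simp add: linearization_def del: One_nat_def)

text \<open>The factor \<open>P\<close> of the Hessian makes the second derivative along the segment
  from \<open>u\<close> to \<open>x\<close> a sum of squares of polynomials \<open>Q k\<close> in
  \<open>s\<close>, with coefficients polynomial in \<open>x\<close>. Weighting the products of
  these coefficients as in Taylor's formula gives psd Gram forms.\<close>

lemma sos_convex_imp_is_sos_remainder: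
  fixes f :: "'n::finite mpoly"
  assumes "sos_convex f"
  shows "is_sos (f - linearization f u)"
proof -
  obtain l :: nat and P where P: "\<And>i j. hess f i j = (\<Sum>k<l. P k i * P k j)"
    using assms unfolding sos_convex_def by blast
  \<comment> \<open>Row \<open>k\<close> of \<open>P\<close>, taken at
    \<open>u + s * (x - u)\<close> and multiplied by the vector \<open>x - u\<close>.\<close>
  define Q where "Q k = (\<Sum>i\<in>UNIV. [:var i - const (u i):] * line_poly u (P k i))" for k
  define n where "n k = degree (Q k)" for k
  define w where "w a b = 1 / ((real (a + b) + 1) * (real (a + b) + 2))" for a b
  have Q: "peval (poly (Q k) (const s)) x =
      (\<Sum>i\<in>UNIV. (x i - u i) * peval (P k i) (\<lambda>i. u i + s * (x i - u i)))" for k s x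
    by (simp add: Q_def poly_sum peval_line_poly del: One_nat_def)
  have Q': "peval (poly (Q k) (const s)) x = (\<Sum>a\<le>n k. peval (coeff (Q k) a) x * s ^ a)" for k s x
    by (simp add: poly_altdef n_def)
  have "f - linearization f u = (\<Sum>k<l. \<Sum>a\<le>n k. \<Sum>b\<le>n k. const (w a b) * (coeff (Q k) a * coeff (Q k) b))"
  proof (rule peval_eqI)
    fix x
    define v where "v i = x i - u i" for i
    define J where "J = (SIGMA k:{..<l}. {..n k} \<times> {..n k})"
    define q where "q = (\<lambda>(k, a, b). peval (coeff (Q k) a) x * peval (coeff (Q k) b) x)"
    define e where "e = (\<lambda>(k :: nat, a, b). a + b :: nat)"
    define g where "g s = peval f (\<lambda>i. u i + s * v i)" for s
    define g1 where "g1 s = (\<Sum>i\<in>UNIV. v i * peval (pderiv i f) (\<lambda>i. u i + s * v i))" for s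
    have J: "(\<Sum>k<l. \<Sum>a\<le>n k. \<Sum>b\<le>n k. h (k, a, b)) = (\<Sum>j\<in>J. h j)" for h :: "_ \<Rightarrow> real"
      by (simp add: J_def sum.Sigma split_def sum.cartesian_product)
    have g: "(g has_real_derivative g1 s) (at s)" for s
      unfolding g_def g1_def by (rule has_real_derivative_peval_line)
    have D: "(g1 has_real_derivative (\<Sum>i\<in>UNIV. v i * (\<Sum>j\<in>UNIV. v j *
        peval (pderiv j (pderiv i f)) (\<lambda>i. u i + s * v i)))) (at s)" for s
      unfolding g1_def by (intro DERIV_sum DERIV_cmult has_real_derivative_peval_line)
    have "(\<Sum>i\<in>UNIV. v i * (\<Sum>j\<in>UNIV. v j * peval (pderiv j (pderiv i f)) (\<lambda>i. u i + s * v i))) =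
        (\<Sum>j\<in>J. q j * s ^ e j)" (is "?L = _") for s
    proof -
      have "?L = (\<Sum>i\<in>UNIV. \<Sum>j\<in>UNIV. \<Sum>k<l. v i * v j *
          (peval (P k j) (\<lambda>i. u i + s * v i) * peval (P k i) (\<lambda>i. u i + s * v i)))"
        by (simp add: P[unfolded hess_def] sum_distrib_left mult_ac)
      also have "\<dots> = (\<Sum>k<l. \<Sum>i\<in>UNIV. \<Sum>j\<in>UNIV. v i * v j *
          (peval (P k j) (\<lambda>i. u i + s * v i) * peval (P k i) (\<lambda>i. u i + s * v i)))"
        by (subst sum.swap[of _ "{..<l}"], subst sum.swap[of _ "{..<l}"]) (rule refl)
      also have "\<dots> = (\<Sum>k<l. peval (poly (Q k) (const s)) x * peval (poly (Q k) (const s)) x)"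
        unfolding Q v_def[symmetric] sum_product by (simp add: mult_ac)
      also have "\<dots> = (\<Sum>k<l. \<Sum>a\<le>n k. \<Sum>b\<le>n k. q (k, a, b) * s ^ e (k, a, b))"
        unfolding Q' sum_product by (simp add: q_def e_def power_add mult_ac)
      also have "\<dots> = (\<Sum>j\<in>J. q j * s ^ e j)"
        by (rule J)
      finally show ?thesis .
    qed
    then have "g 1 = g 0 + g1 0 + (\<Sum>j\<in>J. q j / ((real (e j) + 1) * (real (e j) + 2)))"
      using D by (intro taylor_power_sum g) simp
    moreover have "g 1 = peval f x" "g 0 + g1 0 = peval (linearization f u) x"
      by (simp_all add: g_def g1_def v_def peval_linearization mult_ac)
    moreover have "(\<Sum>j\<in>J. q j / ((real (e j) + 1) * (real (e j) + 2))) =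
      peval (\<Sum>k<l. \<Sum>a\<le>n k. \<Sum>b\<le>n k. const (w a b) * (coeff (Q k) a * coeff (Q k) b)) x"
      by (simp add: J[symmetric] q_def e_def w_def)
    ultimately show "peval (f - linearization f u) x =
      peval (\<Sum>k<l. \<Sum>a\<le>n k. \<Sum>b\<le>n k. const (w a b) * (coeff (Q k) a * coeff (Q k) b)) x"
      by simp
  qed
  also have "is_sos \<dots>"
    unfolding w_def by (intro is_sos_sum is_sos_psd_form psd_on_taylor_weights) (auto simp: add_ac)
  finally show ?thesis .
qed

section \<open>Moment functionals and sums of squares\<close>

text \<open>Removing the constant coefficient and dividing by \<open>t\<close> lowers the growth
  exponent by one; in the base case a nonconstant polynomial would be unbounded.\<close>

lemma degree_le_of_growth:
  fixes r :: "real poly"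
  assumes "\<And>t. 1 \<le> t \<Longrightarrow> \<bar>poly r t\<bar> \<le> C * t ^ n"
  shows "degree r \<le> n"
  using assms
proof (induction n arbitrary: r C)
  case 0
  obtain a p where r: "r = pCons a p" by (cases r)
  have "p = 0"
  proof (rule ccontr)
    assume "p \<noteq> 0"
    then obtain z where z: "\<And>t. z \<le> norm t \<Longrightarrow> C + 1 \<le> norm (poly (pCons a p) t)"
      using poly_infinity by blast
    from z[of "max 1 z"] "0.prems"[of "max 1 z"] show False by (simp add: r)
  qed
  then show ?case by (simp add: r)
next
  case (Suc n)
  obtain a p where r: "r = pCons a p" by (cases r)
  have "\<bar>poly p t\<bar> \<le> (C + \<bar>a\<bar>) * t ^ n" if t: "1 \<le> t" for t
  proof -
    have "t * \<bar>poly p t\<bar> = \<bar>poly r t - a\<bar>" using t by (simp add: r abs_mult)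
    also have "\<dots> \<le> C * t ^ Suc n + \<bar>a\<bar>" using Suc.prems[OF t] by linarith
    also have "\<bar>a\<bar> \<le> \<bar>a\<bar> * t ^ Suc n" using one_le_power[OF t, of "Suc n"] by (simp only: mult_le_cancel_left1) auto
    finally have "t * \<bar>poly p t\<bar> \<le> t * ((C + \<bar>a\<bar>) * t ^ n)" by (simp add: algebra_simps)
    then show ?thesis using t by (simp add: mult_le_cancel_left_pos)
  qed
  from Suc.IH[OF this] have "degree p \<le> n" .
  then show ?case by (simp add: r)
qed

lemma poly_growth:
  fixes r :: "real poly"
  assumes "degree r \<le> n" "1 \<le> t"
  shows "\<bar>poly r t\<bar> \<le> (\<Sum>i\<le>degree r. \<bar>coeff r i\<bar>) * t ^ n"
proof -
  have "\<bar>poly r t\<bar> \<le> (\<Sum>i\<le>degree r. \<bar>coeff r i * t ^ i\<bar>)"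
    unfolding poly_altdef by (rule sum_abs)
  also have "\<dots> \<le> (\<Sum>i\<le>degree r. \<bar>coeff r i\<bar> * t ^ n)"
    using assms by (intro sum_mono) (auto simp: abs_mult intro!: mult_left_mono power_increasing)
  finally show ?thesis by (simp add: sum_distrib_right)
qed

text \<open>The coefficient of \<open>t ^ k\<close> is the homogeneous part of \<open>p\<close> of
  degree \<open>k\<close>, evaluated at \<open>x\<close>.\<close>

definition ray_poly :: "'n::finite mpoly \<Rightarrow> ('n \<Rightarrow> real) \<Rightarrow> real poly" where
  "ray_poly p x = (\<Sum>\<alpha>\<in>Poly_Mapping.keys p.
     Polynomial.monom (Poly_Mapping.lookup p \<alpha> * mon x \<alpha>) (tdeg \<alpha>))"

lemma mon_scale: "mon (\<lambda>i. t * x i) \<alpha> = t ^ tdeg \<alpha> * mon x \<alpha>"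
  by (simp add: mon_def tdeg_def power_mult_distrib prod.distrib power_sum)

lemma poly_ray_poly: "poly (ray_poly p x) t = peval p (\<lambda>i. t * x i)"
  by (simp add: ray_poly_def poly_sum poly_monom peval_eq_Ly Ly_def mon_scale mult_ac)

lemma degree_ray_poly_le:
  assumes "pdeg p \<le> n"
  shows "degree (ray_poly p x) \<le> n"
  unfolding ray_poly_def using assms
  by (intro degree_sum_le) (auto simp: pdeg_le_iff in_keys_iff intro: order.trans[OF degree_monom_le])

lemma pdeg_le_ray_polyI:
  assumes "\<And>x. degree (ray_poly p x) \<le> n"
  shows "pdeg p \<le> n"
  unfolding pdeg_le_iff
proof safe
  fix \<alpha> assume \<alpha>: "Poly_Mapping.lookup p \<alpha> \<noteq> 0"
  show "tdeg \<alpha> \<le> n"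
  proof (rule ccontr)
    assume k: "\<not> tdeg \<alpha> \<le> n"
    \<comment> \<open>The homogeneous part of \<open>p\<close> of degree
      \<open>tdeg \<alpha>\<close>. Its values are coefficients beyond the degree of the ray
      polynomials, so it vanishes, although it keeps the coefficient at
      \<open>\<alpha>\<close>.\<close>
    define h where "h = (\<Sum>\<beta>\<in>Poly_Mapping.keys p.
      Poly_Mapping.single \<beta> (if tdeg \<beta> = tdeg \<alpha> then Poly_Mapping.lookup p \<beta> else 0))"
    have "peval h x = coeff (ray_poly p x) (tdeg \<alpha>)" for x
      by (auto simp: h_def ray_poly_def coeff_sum peval_single intro!: sum.cong)
    also have "\<dots> x = 0" for x
      using assms[of x] k by (intro coeff_eq_0) simp
    finally have "h = 0" by (intro peval_eq_0_imp_eq_0)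
    moreover have "Poly_Mapping.lookup h \<alpha> = Poly_Mapping.lookup p \<alpha>"
      using \<alpha> by (simp add: h_def lookup_sum lookup_single when_def in_keys_iff)
    ultimately show False using \<alpha> by simp
  qed
qed

text \<open>Leading terms of squares cannot cancel: on every ray one square is at most the whole
  sum, which grows at most like \<open>t ^ (2 * n)\<close>, so its factor grows at most like
  \<open>t ^ n\<close>.\<close>

lemma pdeg_sum_squares_le:
  assumes "pdeg (\<Sum>q\<leftarrow>qs. q * q) \<le> 2 * n" "p \<in> set qs"
  shows "pdeg p \<le> n"
proof (rule pdeg_le_ray_polyI)
  fix x
  define r where "r = ray_poly (\<Sum>q\<leftarrow>qs. q * q) x"
  define C where "C = (\<Sum>i\<le>degree r. \<bar>coeff r i\<bar>)"
  have "\<bar>poly (ray_poly p x) t\<bar> \<le> sqrt C * t ^ n" if t: "1 \<le> t" for t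
  proof -
    define z where "z = (\<lambda>i. t * x i)"
    have "peval p z * peval p z \<le> (\<Sum>q\<leftarrow>qs. peval q z * peval q z)"
      by (rule member_le_sum_list) (use assms in auto)
    also have "\<dots> = poly r t"
      by (simp add: r_def poly_ray_poly peval_sum_list z_def)
    also have "\<dots> \<le> C * t ^ (2 * n)"
      using poly_growth[OF degree_ray_poly_le[OF assms(1)] t, of x] unfolding r_def C_def by linarith
    finally have "peval p z * peval p z \<le> C * t ^ (2 * n)" .
    then have "sqrt (peval p z * peval p z) \<le> sqrt (C * t ^ (2 * n))"
      by (rule real_sqrt_le_mono)
    moreover have "t ^ (2 * n) = (t ^ n) ^ 2"
      by (rule power_even_eq)
    ultimately have "\<bar>peval p z\<bar> \<le> sqrt C * \<bar>t ^ n\<bar>"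
      by (simp only: real_sqrt_mult real_sqrt_mult_self real_sqrt_abs)
    then show ?thesis
      using t by (simp add: poly_ray_poly z_def)
  qed
  then show "degree (ray_poly p x) \<le> n" by (rule degree_le_of_growth)
qed

section \<open>Moment matrices and Jensen's inequality\<close>

lemma finite_mons [simp]: "finite (mons d)"
proof (rule finite_imageD)
  have "Poly_Mapping.lookup \<alpha> i \<le> d" if "\<alpha> \<in> mons d" for \<alpha> :: "'a \<Rightarrow>\<^sub>0 nat" and i
    using that member_le_sum[of i UNIV "Poly_Mapping.lookup \<alpha>"] by (auto simp: mons_def tdeg_def)
  then have "Poly_Mapping.lookup ` (mons d :: ('a \<Rightarrow>\<^sub>0 nat) set) \<subseteq> Pi\<^sub>E UNIV (\<lambda>_. {..d})"
    by (auto simp: PiE_UNIV_domain)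
  moreover have "finite (Pi\<^sub>E (UNIV :: 'a set) (\<lambda>_. {..d}))"
    by (rule finite_PiE) simp_all
  ultimately show "finite (Poly_Mapping.lookup ` (mons d :: ('a \<Rightarrow>\<^sub>0 nat) set))"
    by (rule finite_subset)
  show "inj_on Poly_Mapping.lookup (mons d :: ('a \<Rightarrow>\<^sub>0 nat) set)"
    by (simp add: inj_on_def)
qed

lemma zero_in_mons [simp]: "0 \<in> mons d"
  by (simp add: mons_def tdeg_def)

lemma Ly_monom [simp]: "Ly y (monom \<alpha>) = y \<alpha>"
  by (simp add: monom_def)

lemma Ly_square_nonneg:
  assumes "psd_on (mons d) (moment_mat y)" "pdeg q \<le> d"
  shows "0 \<le> Ly y (q * q)"
proof -
  define c where "c = Poly_Mapping.lookup q"
  have "Poly_Mapping.keys q \<subseteq> mons d"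
    using assms(2) by (auto simp: mons_def in_keys_iff pdeg_le_iff)
  then have "q = (\<Sum>\<alpha>\<in>mons d. Poly_Mapping.single \<alpha> (c \<alpha>))"
    unfolding c_def by (intro poly_mapping_sum_single) auto
  then have "Ly y (q * q) = Ly y ((\<Sum>\<alpha>\<in>mons d. Poly_Mapping.single \<alpha> (c \<alpha>)) *
      (\<Sum>\<alpha>\<in>mons d. Poly_Mapping.single \<alpha> (c \<alpha>)))"
    by simp
  also have "\<dots> = (\<Sum>\<alpha>\<in>mons d. \<Sum>\<beta>\<in>mons d. c \<alpha> * c \<beta> * moment_mat y \<alpha> \<beta>)"
    by (simp add: sum_product mult_single Ly_sum moment_mat_def)
  finally show ?thesis using assms(1) unfolding psd_on_def by simp
qed

lemma Ly_is_sos_nonneg: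
  assumes "psd_on (mons d) (moment_mat y)" "is_sos p" "pdeg p \<le> 2 * d"
  shows "0 \<le> Ly y p"
proof -
  obtain qs where qs: "p = (\<Sum>q\<leftarrow>qs. q * q)"
    using assms(2) unfolding is_sos_def by blast
  have "0 \<le> Ly y (q * q)" if "q \<in> set qs" for q
    using pdeg_sum_squares_le[of qs d q] assms that qs by (intro Ly_square_nonneg) auto
  then show ?thesis unfolding qs by (auto simp: Ly_sum_list intro!: sum_list_nonneg)
qed

lemma pdeg_var_le: "pdeg (var i) \<le> 1"
  unfolding pdeg_le_iff by (auto simp: monom_def lookup_single when_def tdeg_single)

text \<open>With \<open>u\<close> the first moments, \<open>y 0 = 1\<close> makes
  \<open>Ly y\<close> vanish on each \<open>var i - const (u i)\<close>, so the linearization at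
  \<open>u\<close> has value \<open>peval f u\<close>; the remainder is a sum of squares.\<close>

lemma sos_convex_jensen:
  assumes "sos_convex f" "pdeg f \<le> 2 * d" "psd_on (mons d) (moment_mat y)" "y 0 = 1"
  shows "peval f (\<lambda>i. y (Poly_Mapping.single i 1)) \<le> Ly y f"
\<comment> \<open>The degree bound on the linearization is obtained termwise from the variables,
  whose degree 1 exceeds \<open>2 * d\<close> when \<open>d = 0\<close>; in that case
  \<open>f\<close> is constant.\<close>
proof (cases "d = 0")
  case True
  with assms(2) have "f = const (Poly_Mapping.lookup f 0)" by (intro pdeg_eq_0_imp_const) simp
  then show ?thesis using assms(4) by (metis Ly_const mult_1_right peval_const order_refl)
next
  case False
  define u where "u = (\<lambda>i. y (Poly_Mapping.single i 1))"
  have "pdeg (var i - const (u i)) \<le> 2 * d" for i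
    using pdeg_var_le[of i] False by (intro pdeg_diff_le) auto
  then have "pdeg (linearization f u) \<le> 2 * d"
    unfolding linearization_def by (intro pdeg_add_le pdeg_sum_le pdeg_const_mult_le) simp_all
  with assms(2) have "pdeg (f - linearization f u) \<le> 2 * d"
    by (rule pdeg_diff_le)
  then have "0 \<le> Ly y (f - linearization f u)"
    using assms by (intro Ly_is_sos_nonneg[of d] sos_convex_imp_is_sos_remainder)
  also have "\<dots> = Ly y f - peval f u"
    using assms(4) by (simp add: linearization_def Ly_diff Ly_add Ly_sum Ly_const_mult u_def)
  finally show ?thesis by (simp add: u_def)
qed

section \<open>SOS-convex polynomials\<close>

lemma sos_convex_first_order:
  assumes "sos_convex f"
  shows "peval (linearization f u) x \<le> peval f x"
  using peval_is_sos_nonneg[OF sos_convex_imp_is_sos_remainder[OF assms, of u], of x] by simp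

lemma sos_convex_convex:
  assumes "sos_convex f" "0 \<le> t" "t \<le> 1"
  shows "peval f (\<lambda>i. (1 - t) * x i + t * y i) \<le> (1 - t) * peval f x + t * peval f y"
proof -
  define u where "u = (\<lambda>i. (1 - t) * x i + t * y i)"
  define c where "c i = peval (pderiv i f) u" for i
  \<comment> \<open>The added sum is zero, since the weighted displacements of \<open>x\<close> and
    \<open>y\<close> from \<open>u\<close> cancel; it splits into the two linearizations at
    \<open>u\<close>.\<close>
  have "peval f u = (1 - t) * peval f u + t * peval f u +
      (\<Sum>i\<in>UNIV. c i * ((1 - t) * (x i - u i) + t * (y i - u i)))"
    by (simp add: u_def algebra_simps)
  also have "\<dots> = (1 - t) * peval (linearization f u) x + t * peval (linearization f u) y"
    by (simp add: peval_linearization c_def distrib_left sum.distrib sum_distrib_left mult_ac)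
  also have "\<dots> \<le> (1 - t) * peval f x + t * peval f y"
    using assms by (intro add_mono mult_left_mono sos_convex_first_order) auto
  finally show ?thesis by (simp add: u_def)
qed

text \<open>Along the line \<open>p\<close> is a univariate polynomial in \<open>t\<close>;
  boundedness on a half-line is growth of order \<open>t ^ 0\<close>, which forces degree 0.\<close>

lemma bounded_on_ray_imp_const_on_line:
  assumes "\<And>t. 1 \<le> t \<Longrightarrow> \<bar>peval p (\<lambda>i. x i + t * v i)\<bar> \<le> C"
  shows "peval p (\<lambda>i. x i + t * v i) = peval p x"
proof -
  define L where "L = line_poly x p"
  define r where "r = (\<Sum>a\<le>degree L. Polynomial.monom (peval (coeff L a) (\<lambda>i. x i + v i)) a)"
  have r: "poly r t = peval p (\<lambda>i. x i + t * v i)" for t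
  proof -
    have "poly r t = peval (poly L (const t)) (\<lambda>i. x i + v i)"
      by (simp add: r_def poly_sum poly_monom poly_altdef[of L])
    then show ?thesis by (simp add: L_def peval_line_poly)
  qed
  have "degree r \<le> 0"
    using assms by (intro degree_le_of_growth[of r C]) (simp add: r)
  then obtain c where "r = [:c:]" by (auto elim: degree_eq_zeroE)
  then have "poly r t = poly r 0" by simp
  then show ?thesis by (simp add: r)
qed

text \<open>Modulo the subspace \<open>V\<close> of directions along which the polynomial is constant, sublevel sets
  are bounded: a recession direction of a sublevel set lies in \<open>V\<close>, because a univariate polynomial
  that is bounded on a half-line is constant.\<close>

lemma sos_convex_attains_min:
  fixes p :: "'n::finite mpoly"
  assumes p: "sos_convex p" and lb: "\<And>x. c \<le> peval p x"
  shows "\<exists>w. \<forall>x. peval p w \<le> peval p x"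
proof -
  define q :: "real ^ 'n \<Rightarrow> real" where "q z = peval p (vec_nth z)" for z
  have cont: "continuous_on UNIV q"
    unfolding q_def peval_def by (intro continuous_intros)
  have conv: "q ((1 - t) *\<^sub>R x + t *\<^sub>R y) \<le> (1 - t) * q x + t * q y" if "0 \<le> t" "t \<le> 1" for t x y
  proof -
    have "vec_nth ((1 - t) *\<^sub>R x + t *\<^sub>R y) = (\<lambda>i. (1 - t) * x $ i + t * y $ i)"
      by (rule ext) simp
    then show ?thesis
      using sos_convex_convex[OF p that, of "vec_nth x" "vec_nth y"] by (simp add: q_def)
  qed
  define V where "V = {v. \<forall>x t. q (x + t *\<^sub>R v) = q x}"
  have "subspace V"
    unfolding subspace_def V_def
  proof (safe, goal_cases)
    case (2 v w x t)
    have "q (x + t *\<^sub>R (v + w)) = q ((x + t *\<^sub>R v) + t *\<^sub>R w)"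
      by (simp add: scaleR_add_right add_ac)
    then show ?case using 2 by simp
  next
    case (3 a v x t)
    then show ?case by (simp add: scaleR_scaleR)
  qed simp
  define W where "W = {z. \<forall>v\<in>V. z \<bullet> v = 0}"
  have "W = (\<Inter>v\<in>V. {z. z \<bullet> v = 0})" by (auto simp: W_def)
  then have "closed W"
    by (auto intro!: closed_INT closed_Collect_eq continuous_intros)
  define S where "S = {z \<in> W. q z \<le> q 0}"
  have "bounded S"
  proof (rule ccontr)
    assume "\<not> bounded S"
    then have "\<exists>z\<in>S. real (Suc n) < norm z" for n
      unfolding bounded_iff by (meson not_le)
    then obtain z where z: "\<And>n. z n \<in> S" "\<And>n. real (Suc n) < norm (z n)" by metis
    define u where "u n = z n /\<^sub>R norm (z n)" for n
    have norm_pos: "0 < norm (z n)" for n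
      using z(2)[of n] by linarith
    then have "u n \<in> sphere 0 1" for n
      by (simp add: u_def)
    then obtain v r where v: "v \<in> sphere 0 1" and r: "strict_mono r" and lim: "(u \<circ> r) \<longlonglongrightarrow> v"
      using compact_sphere[of "0 :: real ^ 'n" 1] unfolding compact_def by metis
    have "u n \<in> W" for n
      using z(1)[of n] by (auto simp: S_def W_def u_def)
    then have "v \<in> W"
      using closed_sequentially[OF \<open>closed W\<close>, of "u \<circ> r" v] lim by auto
    \<comment> \<open>\<open>x + t *\<^sub>R v\<close> is the limit of convex combinations of
      \<open>x\<close> and \<open>z (r n)\<close> with weight \<open>t / norm (z (r n))\<close>
      tending to 0; convexity and \<open>q (z (r n)) \<le> q 0\<close> bound their values.\<close>
    have dec: "q (x + t *\<^sub>R v) \<le> q x" if t: "0 \<le> t" for x t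
    proof -
      define l where "l n = t / norm (z (r n))" for n
      have "(\<lambda>n. norm (z (r n))) \<longlonglongrightarrow> \<infinity>"
      proof (rule tendsto_PInfty_eq_at_top[THEN iffD2], rule filterlim_at_top_mono[OF filterlim_real_sequentially])
        show "\<forall>\<^sub>F n in sequentially. real n \<le> norm (z (r n))"
          using z(2) seq_suble[OF r] by (intro always_eventually allI) (smt (verit) of_nat_Suc of_nat_mono)
      qed
      then have "filterlim (\<lambda>n. norm (z (r n))) at_top sequentially"
        by (simp add: tendsto_PInfty_eq_at_top)
      then have l0: "l \<longlonglongrightarrow> 0"
        unfolding l_def by (intro real_tendsto_divide_at_top[OF tendsto_const])
      have "(\<lambda>n. (1 - l n) *\<^sub>R x + t *\<^sub>R (u \<circ> r) n) \<longlonglongrightarrow> (1 - 0) *\<^sub>R x + t *\<^sub>R v"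
        by (intro tendsto_intros l0 lim)
      then have "(\<lambda>n. q ((1 - l n) *\<^sub>R x + t *\<^sub>R (u \<circ> r) n)) \<longlonglongrightarrow> q ((1 - 0) *\<^sub>R x + t *\<^sub>R v)"
        using continuous_on_tendsto_compose[OF cont] by simp
      moreover have "(\<lambda>n. (1 - l n) * q x + l n * q 0) \<longlonglongrightarrow> (1 - 0) * q x + 0 * q 0"
        by (intro tendsto_intros l0)
      moreover have "\<forall>\<^sub>F n in sequentially. q ((1 - l n) *\<^sub>R x + t *\<^sub>R (u \<circ> r) n) \<le> (1 - l n) * q x + l n * q 0"
      proof -
        have "\<forall>\<^sub>F n in sequentially. l n < 1"
          using l0 by (rule order_tendstoD) simp
        then show ?thesis
        proof eventually_elim
          case (elim n)
          have l: "0 \<le> l n" using t by (simp add: l_def)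
          have "t *\<^sub>R (u \<circ> r) n = l n *\<^sub>R z (r n)"
            by (simp add: l_def u_def divide_inverse)
          then have "q ((1 - l n) *\<^sub>R x + t *\<^sub>R (u \<circ> r) n) \<le> (1 - l n) * q x + l n * q (z (r n))"
            using conv[of "l n" x "z (r n)"] elim l by simp
          also have "q (z (r n)) \<le> q 0"
            using z(1)[of "r n"] by (simp add: S_def)
          finally show ?case using l by (simp add: mult_left_mono)
        qed
      qed
      ultimately show ?thesis
        using tendsto_le[OF trivial_limit_sequentially] by fastforce
    qed
    \<comment> \<open>\<open>dec\<close> bounds \<open>q\<close> above on the half-line and
      \<open>c\<close> bounds it below, so \<open>q\<close> is constant on the line. Thus
      \<open>v\<close> lies in both \<open>V\<close> and \<open>W\<close>, and a unit vector would
      be orthogonal to itself.\<close>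
    have "q (x + t *\<^sub>R v) = q x" for x t
    proof -
      have line: "q (x + t *\<^sub>R v) = peval p (\<lambda>i. x $ i + t * v $ i)" for t
        unfolding q_def by (rule arg_cong[of _ _ "peval p"], rule ext) simp
      have "\<bar>peval p (\<lambda>i. x $ i + t * v $ i)\<bar> \<le> \<bar>c\<bar> + \<bar>q x\<bar>" if "1 \<le> t" for t
        using dec[of t x] lb[of "\<lambda>i. x $ i + t * v $ i"] that by (simp add: line)
      from bounded_on_ray_imp_const_on_line[OF this] show ?thesis by (simp add: line) (simp add: q_def)
    qed
    then have "v \<in> V" by (simp add: V_def)
    with \<open>v \<in> W\<close> have "v \<bullet> v = 0" by (simp add: W_def)
    with v show False by simp
  qed
  moreover have "closed S"
  proof -
    have "S = W \<inter> {z. q z \<le> q 0}" by (auto simp: S_def)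
    then show ?thesis
      using \<open>closed W\<close> by (auto intro!: closed_Int closed_Collect_le cont continuous_on_const)
  qed
  ultimately have "compact S" by (simp add: compact_eq_bounded_closed)
  moreover have "0 \<in> S" by (simp add: S_def W_def)
  ultimately obtain w where w: "w \<in> S" "\<And>z. z \<in> S \<Longrightarrow> q w \<le> q z"
    using continuous_attains_inf[of S q] continuous_on_subset[OF cont] by blast
  \<comment> \<open>Dropping the component in \<open>V\<close> does not change \<open>q\<close>; if
    the remaining point lies outside \<open>S\<close>, its value exceeds \<open>q 0\<close>.\<close>
  have "q w \<le> q x" for x
  proof -
    obtain v z where vz: "v \<in> span V" "\<And>a. a \<in> span V \<Longrightarrow> orthogonal z a" "x = v + z"
      using orthogonal_subspace_decomp_exists[of V x] by metis
    have "v \<in> V" using vz(1) \<open>subspace V\<close> by (simp add: span_eq_iff[THEN iffD2])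
    then have "q (z + 1 *\<^sub>R v) = q z" unfolding V_def by blast
    then have "q x = q z" using vz(3) by (simp add: add.commute)
    moreover have "z \<in> W" using vz(2) by (auto simp: W_def orthogonal_def span_base)
    ultimately show ?thesis
      using w(2)[of z] w(2)[OF \<open>0 \<in> S\<close>] by (cases "q z \<le> q 0") (auto simp: S_def)
  qed
  then have "peval p (vec_nth w) \<le> peval p x" for x
    using q_def[of w] q_def[of "\<chi> i. x i"] by (metis vec_nth_inverse vec_lambda_inverse UNIV_I)
  then show ?thesis by blast
qed

lemma peval_pderiv_eq_0_at_min:
  assumes "\<And>x. peval p w \<le> peval p x"
  shows "peval (pderiv i p) w = 0"
proof -
  define v :: "'a \<Rightarrow> real" where "v = (\<lambda>j. if j = i then 1 else 0)"
  have "(\<Sum>i\<in>UNIV. v i * peval (pderiv i p) (\<lambda>i. w i + 0 * v i)) = 0"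
    by (rule DERIV_local_min[OF has_real_derivative_peval_line zero_less_one]) (simp add: assms)
  then show ?thesis by (simp add: v_def if_distrib[of "\<lambda>z. z * _"] cong: if_cong)
qed

lemma sos_convex_minus_min_is_sos:
  assumes "sos_convex p" "\<And>x. peval p w \<le> peval p x"
  shows "is_sos (p - const (peval p w))"
  using sos_convex_imp_is_sos_remainder[OF assms(1), of w] peval_pderiv_eq_0_at_min[OF assms(2)]
  by (simp add: linearization_def)

section \<open>The Lagrangian and feasibility through quadratic forms\<close>

lemma sos_convex_add:
  assumes "sos_convex p" "sos_convex q"
  shows "sos_convex (p + q)"
proof -
  obtain k :: nat and P where P: "\<And>i j. hess p i j = (\<Sum>a<k. P a i * P a j)"
    using assms(1) unfolding sos_convex_def by blast
  obtain l :: nat and Q where Q: "\<And>i j. hess q i j = (\<Sum>a<l. Q a i * Q a j)"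
    using assms(2) unfolding sos_convex_def by blast
  define R where "R a = (if a < k then P a else Q (a - k))" for a :: nat
  have split: "(\<Sum>a<k + l. g a) = (\<Sum>a<k. g a) + (\<Sum>a<l. g (k + a))" for g :: "nat \<Rightarrow> 'a mpoly" and l
    by (induction l) (auto simp: add_ac)
  have "hess (p + q) i j = (\<Sum>a<k + l. R a i * R a j)" for i j
    unfolding split using P[of i j] Q[of i j] by (simp add: R_def hess_def pderiv_add)
  then show ?thesis unfolding sos_convex_def by blast
qed

lemma sos_convex_uminus_quad_form:
  assumes "neg_sos_convex_mat G"
  shows "sos_convex (- quad_form G \<xi>)"
  using assms unfolding neg_sos_convex_mat_def sos_convex_def by (simp add: hess_def pderiv_uminus)

text \<open>A psd multiplier is carried as a list of vectors whose outer products add up to it;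
  pairing it with \<open>G\<close> is then a sum of quadratic forms, each covered by the hypothesis
  on \<open>G\<close>.\<close>

lemma sos_convex_minus_quad_forms:
  assumes "sos_convex f" "neg_sos_convex_mat G"
  shows "sos_convex (f - (\<Sum>v\<leftarrow>vs. quad_form G v))"
proof (induction vs)
  case (Cons v vs)
  from sos_convex_add[OF Cons sos_convex_uminus_quad_form[OF assms(2), of v]]
  show ?case by (simp add: algebra_simps)
qed (use assms in simp)

lemma peval_quad_form:
  "peval (quad_form G \<xi>) x = (\<Sum>i\<in>UNIV. \<Sum>j\<in>UNIV. \<xi> i * \<xi> j * peval (G i j) x)"
  by (simp add: quad_form_def)

lemma feasible_iff: "x \<in> feasible G \<longleftrightarrow> (\<forall>\<xi>. 0 \<le> peval (quad_form G \<xi>) x)"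
  by (simp add: feasible_def psd_on_def mat_eval_def peval_quad_form)

text \<open>Reads off signs of multipliers: a separating functional is nonnegative along half-lines
  inside the separated set, so its slope there cannot be negative.\<close>

lemma nonneg_slopeI:
  fixes a b :: real
  assumes "\<And>t. 0 \<le> t \<Longrightarrow> 0 \<le> a + t * b"
  shows "0 \<le> b"
proof (rule ccontr)
  assume "\<not> 0 \<le> b"
  then have "0 \<le> (\<bar>a\<bar> + 1) / - b" "(\<bar>a\<bar> + 1) / - b * b = - (\<bar>a\<bar> + 1)"
    by (auto simp: field_simps)
  with assms[of "(\<bar>a\<bar> + 1) / - b"] show False by linarith
qed

section \<open>Lagrange multipliers and moment relaxations\<close>

lemma pdeg_monom_mult_le:
  assumes "pdeg p \<le> n"
  shows "pdeg (p * monom \<gamma>) \<le> n + tdeg \<gamma>"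
proof -
  have sub: "Poly_Mapping.keys (p * monom \<gamma>) \<subseteq> {a + b |a b. a \<in> Poly_Mapping.keys p \<and> b \<in> {\<gamma>}}"
    using keys_mult[of p "monom \<gamma>"] by (simp add: monom_def)
  show ?thesis
    unfolding pdeg_le_iff
  proof safe
    fix \<beta> assume "Poly_Mapping.lookup (p * monom \<gamma>) \<beta> \<noteq> 0"
    then have "\<beta> \<in> Poly_Mapping.keys (p * monom \<gamma>)" by (simp add: in_keys_iff)
    with sub obtain \<alpha> where "\<beta> = \<alpha> + \<gamma>" "Poly_Mapping.lookup p \<alpha> \<noteq> 0"
      by (auto simp: in_keys_iff)
    then show "tdeg \<beta> \<le> n + tdeg \<gamma>"
      using assms by (simp add: pdeg_le_iff tdeg_add)
  qed
qed

lemma pdeg_le_mat_deg: "pdeg (G i j) \<le> mat_deg G"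
  unfolding mat_deg_def by (rule Max_ge) (auto intro: image_eqI[of _ _ "(i, j)"])

lemma pd_on_imp_feasible:
  assumes "pd_on UNIV (mat_eval G u)"
  shows "u \<in> feasible G"
  unfolding feasible_def psd_on_def
proof safe
  fix c :: "'a \<Rightarrow> real"
  show "0 \<le> (\<Sum>a\<in>UNIV. \<Sum>b\<in>UNIV. c a * c b * mat_eval G u a b)"
    using assms unfolding pd_on_def
    by (cases "\<exists>a. c a \<noteq> 0") (auto intro: less_imp_le)
qed

text \<open>Separation yields a functional with components \<open>\<alpha>\<close> and
  \<open>B\<close>; the symmetric part of \<open>- B\<close>, divided by \<open>\<alpha>\<close>, is
  the multiplier, returned as a list of vectors with their outer products as summands.\<close>

lemma sos_convex_lagrange_multipliers:
  fixes f :: "'n::finite mpoly" and G :: "'m::finite \<Rightarrow> 'm \<Rightarrow> 'n mpoly"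
  assumes f: "sos_convex f" and sym: "symmetric_mat G" and G: "neg_sos_convex_mat G"
    and slater: "pd_on UNIV (mat_eval G u)" and lb: "\<And>x. x \<in> feasible G \<Longrightarrow> c \<le> peval f x"
  shows "\<exists>vs. \<forall>x. c + (\<Sum>v\<leftarrow>vs. peval (quad_form G v) x) \<le> peval f x"
proof -
  define qf :: "real ^ 'm ^ 'm \<Rightarrow> ('m \<Rightarrow> real) \<Rightarrow> real"
    where "qf S \<xi> = (\<Sum>i\<in>UNIV. \<Sum>j\<in>UNIV. \<xi> i * \<xi> j * S $ i $ j)" for S \<xi>
  define Gm :: "('n \<Rightarrow> real) \<Rightarrow> real ^ 'm ^ 'm" where "Gm x = (\<chi> i j. peval (G i j) x)" for x
  have qf_add: "qf (S + T) \<xi> = qf S \<xi> + qf T \<xi>" for S T \<xi>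
    by (simp add: qf_def distrib_left sum.distrib)
  have qf_scale: "qf (t *\<^sub>R S) \<xi> = t * qf S \<xi>" for t S \<xi>
    by (simp add: qf_def sum_distrib_left mult_ac)
  have qf_Gm: "qf (Gm x) \<xi> = peval (quad_form G \<xi>) x" for x \<xi>
    by (simp add: qf_def Gm_def peval_quad_form)
  \<comment> \<open>Convex because \<open>f\<close> is convex and the quadratic forms of
    \<open>G\<close> are concave in \<open>x\<close>; strictness in the first component keeps the
    origin out. \<open>S\<close> ranges over all matrices and is compared with \<open>Gm x\<close>
    through quadratic forms.\<close>
  define A where "A = {(r, S). \<exists>x. peval f x - c < r \<and> (\<forall>\<xi>. qf S \<xi> \<le> peval (quad_form G \<xi>) x)}"
  have "0 \<notin> A"
  proof
    assume "0 \<in> A"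
    then obtain x where x: "peval f x - c < 0" "\<And>\<xi>. 0 \<le> peval (quad_form G \<xi>) x"
      by (auto simp: A_def zero_prod_def qf_def)
    with lb[of x] show False by (simp add: feasible_iff)
  qed
  moreover have "convex A"
    unfolding convex_alt
  proof (intro ballI allI impI)
    fix a b t assume ab: "a \<in> A" "b \<in> A" and t: "0 \<le> t \<and> t \<le> (1::real)"
    obtain r S r' S' where [simp]: "a = (r, S)" "b = (r', S')" by (cases a, cases b)
    obtain x where x: "peval f x - c < r" "\<And>\<xi>. qf S \<xi> \<le> peval (quad_form G \<xi>) x"
      using ab by (auto simp: A_def)
    obtain y where y: "peval f y - c < r'" "\<And>\<xi>. qf S' \<xi> \<le> peval (quad_form G \<xi>) y"
      using ab by (auto simp: A_def)
    define z where "z = (\<lambda>i. (1 - t) * x i + t * y i)"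
    have "peval f z \<le> (1 - t) * peval f x + t * peval f y"
      unfolding z_def using t by (intro sos_convex_convex f) auto
    \<comment> \<open>Strictness must come from a point with positive weight: \<open>y\<close> if
      \<open>t\<close> is nonzero, otherwise \<open>x\<close>.\<close>
    also have "\<dots> < (1 - t) * (r + c) + t * (r' + c)"
    proof (cases "t = 0")
      case False
      then have "t * peval f y < t * (r' + c)" using t y by simp
      moreover have "(1 - t) * peval f x \<le> (1 - t) * (r + c)" using t x by (intro mult_left_mono) auto
      ultimately show ?thesis by linarith
    qed (use x in simp)
    finally have "peval f z - c < (1 - t) * r + t * r'" by (simp add: algebra_simps)
    moreover have "qf ((1 - t) *\<^sub>R S + t *\<^sub>R S') \<xi> \<le> peval (quad_form G \<xi>) z" for \<xi>
    proof -
      have "peval (- quad_form G \<xi>) z \<le> (1 - t) * peval (- quad_form G \<xi>) x + t * peval (- quad_form G \<xi>) y"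
        unfolding z_def using t by (intro sos_convex_convex sos_convex_uminus_quad_form G) auto
      moreover have "(1 - t) * qf S \<xi> \<le> (1 - t) * peval (quad_form G \<xi>) x"
        "t * qf S' \<xi> \<le> t * peval (quad_form G \<xi>) y"
        using t x y by (auto intro!: mult_left_mono)
      ultimately show ?thesis by (simp add: qf_add qf_scale)
    qed
    ultimately show "(1 - t) *\<^sub>R a + t *\<^sub>R b \<in> A"
      by (auto simp: A_def)
  qed
  ultimately obtain h where "h \<noteq> 0" "\<forall>a\<in>A. 0 \<le> inner h a"
    using separating_hyperplane_set_0[of A] by blast
  then obtain \<alpha> B where nz: "(\<alpha>, B) \<noteq> 0" and sep: "\<And>r S. (r, S) \<in> A \<Longrightarrow> 0 \<le> \<alpha> * r + inner B S"
    by (cases h) force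
  have GmA: "(r, Gm x) \<in> A" if "peval f x - c < r" for r x
    using that by (auto simp: A_def qf_Gm)
  have "0 \<le> \<alpha>"
  proof (rule nonneg_slopeI)
    fix t :: real assume "0 \<le> t"
    then have "0 \<le> \<alpha> * (peval f u - c + 1 + t) + inner B (Gm u)"
      by (intro sep GmA) simp
    then show "0 \<le> \<alpha> * (peval f u - c + 1) + inner B (Gm u) + t * \<alpha>"
      by (simp add: algebra_simps)
  qed
  \<comment> \<open>Lowering the matrix component by \<open>t *\<^sub>R Q\<close> stays inside
    \<open>A\<close>, so \<open>inner B Q\<close> cannot be positive.\<close>
  have polar: "inner B Q \<le> 0" if "\<And>\<xi>. 0 \<le> qf Q \<xi>" for Q
  proof -
    have "0 \<le> - inner B Q"
    proof (rule nonneg_slopeI)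
      fix t :: real assume "0 \<le> t"
      then have "qf (Gm u + (- t) *\<^sub>R Q) \<xi> \<le> peval (quad_form G \<xi>) u" for \<xi>
        using that[of \<xi>] by (simp add: qf_add qf_scale qf_Gm del: scaleR_minus_left)
      then have "(peval f u - c + 1, Gm u + (- t) *\<^sub>R Q) \<in> A"
        unfolding A_def by (auto intro!: exI[of _ u])
      from sep[OF this] show "0 \<le> \<alpha> * (peval f u - c + 1) + inner B (Gm u) + t * - inner B Q"
        by (simp add: inner_diff_right)
    qed
    then show ?thesis by simp
  qed
  have innerB: "inner B S = (\<Sum>i\<in>UNIV. \<Sum>j\<in>UNIV. B $ i $ j * S $ i $ j)" for S
    by (simp add: inner_vec_def)
  \<comment> \<open>\<open>B\<close> need not be symmetric; its symmetric part pairs identically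
    with symmetric matrices, and the sign is reversed to make it psd.\<close>
  define w where "w i j = - (B $ i $ j + B $ j $ i) / 2" for i j
  have w_form: "(\<Sum>i\<in>UNIV. \<Sum>j\<in>UNIV. w i j * g i j) = - (\<Sum>i\<in>UNIV. \<Sum>j\<in>UNIV. B $ i $ j * g i j)"
    if "\<And>i j. g i j = g j i" for g
  proof -
    have "(\<Sum>i\<in>UNIV. \<Sum>j\<in>UNIV. B $ j $ i * g i j) = (\<Sum>i\<in>UNIV. \<Sum>j\<in>UNIV. B $ i $ j * g i j)"
      by (subst sum.swap) (simp add: that)
    then have "(\<Sum>i\<in>UNIV. \<Sum>j\<in>UNIV. (B $ i $ j + B $ j $ i) * g i j) =
        2 * (\<Sum>i\<in>UNIV. \<Sum>j\<in>UNIV. B $ i $ j * g i j)"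
      by (simp add: distrib_right sum.distrib)
    moreover have "(\<Sum>i\<in>UNIV. \<Sum>j\<in>UNIV. w i j * g i j) =
        - ((\<Sum>i\<in>UNIV. \<Sum>j\<in>UNIV. (B $ i $ j + B $ j $ i) * g i j) / 2)"
      unfolding w_def sum_divide_distrib sum_negf[symmetric]
      by (intro sum.cong refl) (simp add: field_simps)
    ultimately show ?thesis by simp
  qed
  have "psd_on UNIV w"
    unfolding psd_on_def
  proof
    fix \<xi> :: "'m \<Rightarrow> real"
    have "qf (\<chi> i j. \<xi> i * \<xi> j) \<eta> = (\<Sum>i\<in>UNIV. \<eta> i * \<xi> i) ^ 2" for \<eta>
      by (simp add: qf_def power2_eq_square sum_product mult_ac)
    then have "inner B (\<chi> i j. \<xi> i * \<xi> j) \<le> 0" by (intro polar) simp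
    then show "0 \<le> (\<Sum>i\<in>UNIV. \<Sum>j\<in>UNIV. \<xi> i * \<xi> j * w i j)"
      using w_form[of "\<lambda>i j. \<xi> i * \<xi> j"] by (simp add: innerB mult_ac)
  qed
  then obtain vs where vs: "\<And>i j. w i j = (\<Sum>v\<leftarrow>vs. v i * v j)"
    using psd_on_imp_sum_squares[of UNIV w] by (auto simp: w_def add.commute)
  have list_form: "(\<Sum>i\<in>UNIV. \<Sum>j\<in>UNIV. (\<Sum>v\<leftarrow>us. v i * v j) * g i j) =
      (\<Sum>v\<leftarrow>us. \<Sum>i\<in>UNIV. \<Sum>j\<in>UNIV. v i * v j * g i j)" for us :: "('m \<Rightarrow> real) list" and g
    by (induction us) (auto simp: distrib_right sum.distrib)
  have innerB_Gm: "inner B (Gm x) = - (\<Sum>v\<leftarrow>vs. peval (quad_form G v) x)" for x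
  proof -
    have "(\<Sum>i\<in>UNIV. \<Sum>j\<in>UNIV. w i j * peval (G i j) x) = - inner B (Gm x)"
      using sym w_form[of "\<lambda>i j. peval (G i j) x"] by (simp add: symmetric_mat_def innerB Gm_def)
    then show ?thesis by (simp add: vs list_form peval_quad_form)
  qed
  \<comment> \<open>If \<open>\<alpha> = 0\<close>, the forms of the vectors in \<open>vs\<close>
    sum to at most 0 at the Slater point \<open>u\<close>, where every nonzero vector has a positive
    form; hence all these vectors vanish.\<close>
  have "\<alpha> \<noteq> 0"
  proof
    assume [simp]: "\<alpha> = 0"
    have pos: "0 < peval (quad_form G v) u" if "v i \<noteq> 0" for v i
      using slater that unfolding pd_on_def by (auto simp: mat_eval_def peval_quad_form)
    have nonneg: "0 \<le> peval (quad_form G v) u" for v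
      using pd_on_imp_feasible[OF slater] by (simp add: feasible_iff)
    have "(\<Sum>v\<leftarrow>vs. peval (quad_form G v) u) \<le> 0"
      using sep[OF GmA[of u "peval f u - c + 1"]] by (simp add: innerB_Gm)
    then have "(\<Sum>v\<leftarrow>vs. peval (quad_form G v) u) = 0"
      using nonneg by (intro antisym sum_list_nonneg) auto
    then have "peval (quad_form G v) u = 0" if "v \<in> set vs" for v
      using that nonneg sum_list_nonneg_eq_0_iff[of "map (\<lambda>v. peval (quad_form G v) u) vs"] by auto
    then have zero: "v i = 0" if "v \<in> set vs" for v i
      using that pos[of v i] by fastforce
    have "w i j = 0" for i j
    proof -
      have "map (\<lambda>v. v i * v j) vs = map (\<lambda>_. 0) vs"
        by (intro map_cong) (simp_all add: zero)
      then show ?thesis by (simp only: vs sum_list_0)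
    qed
    \<comment> \<open>Since \<open>w = 0\<close>, \<open>B\<close> is antisymmetric and its
      quadratic form vanishes, so \<open>B\<close> itself may be inserted in \<open>polar\<close>;
      this excludes a nonzero \<open>B\<close>.\<close>
    moreover have "qf B \<xi> = - (\<Sum>i\<in>UNIV. \<Sum>j\<in>UNIV. w i j * (\<xi> i * \<xi> j))" for \<xi>
      using w_form[of "\<lambda>i j. \<xi> i * \<xi> j"] by (simp add: qf_def mult_ac)
    ultimately have "inner B B \<le> 0"
      by (intro polar) simp
    then have "B = 0" by (metis inner_gt_zero_iff not_le)
    then show False using nz by (simp add: zero_prod_def)
  qed
  with \<open>0 \<le> \<alpha>\<close> have \<alpha>: "0 < \<alpha>" by simp
  define us where "us = map (\<lambda>v i. v i / sqrt \<alpha>) vs"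
  have "peval (quad_form G (\<lambda>i. v i / sqrt \<alpha>)) x = peval (quad_form G v) x / \<alpha>" for v x
    using \<alpha> by (simp add: peval_quad_form sum_divide_distrib)
  then have us: "(\<Sum>v\<leftarrow>us. peval (quad_form G v) x) = (\<Sum>v\<leftarrow>vs. peval (quad_form G v) x) / \<alpha>" for x
    unfolding us_def by (induction vs) (auto simp: add_divide_distrib o_def)
  \<comment> \<open>Membership in \<open>A\<close> is strict in the first component, hence the slack
    \<open>e\<close>.\<close>
  have "c + (\<Sum>v\<leftarrow>us. peval (quad_form G v) x) \<le> peval f x" for x
  proof (rule field_le_epsilon)
    fix e :: real assume "0 < e"
    then have "0 \<le> \<alpha> * (peval f x - c + e) - (\<Sum>v\<leftarrow>vs. peval (quad_form G v) x)"
      using sep[OF GmA[of x "peval f x - c + e"]] by (simp add: innerB_Gm)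
    then show "c + (\<Sum>v\<leftarrow>us. peval (quad_form G v) x) \<le> peval f x + e"
      unfolding us using \<alpha> by (simp add: field_simps)
  qed
  then show ?thesis by blast
qed

section \<open>Weak and strong duality for the truncated quadratic module\<close>

lemma vGv_const: "vGv G (\<lambda>i. const (v i)) = quad_form G v"
  by (simp add: vGv_def quad_form_def const_mult mult_ac)

lemma in_QM_imp_le:
  assumes "in_QM k G (f - const \<gamma>)" "x \<in> feasible G"
  shows "\<gamma> \<le> peval f x"
proof -
  obtain \<sigma> vs where \<sigma>: "is_sos \<sigma>" and eq: "f - const \<gamma> = \<sigma> + (\<Sum>v\<leftarrow>vs. vGv G v)"
    using assms(1) unfolding in_QM_def by blast
  have "peval (vGv G v) x = peval (quad_form G (\<lambda>i. peval (v i) x)) x" for v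
    by (simp add: vGv_def peval_quad_form mult_ac)
  then have "0 \<le> (\<Sum>v\<leftarrow>vs. peval (vGv G v) x)"
    using assms(2) by (auto simp: feasible_iff intro!: sum_list_nonneg)
  then show ?thesis
    using arg_cong[OF eq, of "\<lambda>p. peval p x"] peval_is_sos_nonneg[OF \<sigma>, of x]
    by (simp add: peval_sum_list)
qed

lemma pdeg_quad_form_le: "mat_deg G \<le> n \<Longrightarrow> pdeg (quad_form G v) \<le> n"
  unfolding quad_form_def
  by (intro pdeg_sum_le pdeg_const_mult_le order.trans[OF pdeg_le_mat_deg])

text \<open>The Lagrangian \<open>p\<close> attains its minimum even if \<open>f\<close> does not
  attain its infimum on the feasible set. Constant vectors keep \<open>vGv G v\<close> within the
  degree of \<open>G\<close>.\<close>

lemma lower_bound_in_QM: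
  fixes f :: "'n::finite mpoly" and G :: "'m::finite \<Rightarrow> 'm \<Rightarrow> 'n mpoly"
  assumes "pdeg f \<le> 2 * d" "symmetric_mat G" "mat_deg G \<le> 2 * d" "sos_convex f" "neg_sos_convex_mat G"
    and "pd_on UNIV (mat_eval G u)" "\<And>x. x \<in> feasible G \<Longrightarrow> c \<le> peval f x"
  shows "in_QM d G (f - const c)"
proof -
  obtain vs where vs: "\<And>x. c + (\<Sum>v\<leftarrow>vs. peval (quad_form G v) x) \<le> peval f x"
    using sos_convex_lagrange_multipliers[OF assms(4,2,5-7)] by blast
  define p where "p = f - (\<Sum>v\<leftarrow>vs. quad_form G v)"
  have p: "sos_convex p"
    unfolding p_def by (intro sos_convex_minus_quad_forms assms)
  have lb: "c \<le> peval p x" for x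
    using vs[of x] by (simp add: p_def peval_sum_list)
  obtain w where w: "\<And>x. peval p w \<le> peval p x"
    using sos_convex_attains_min[OF p lb] by blast
  \<comment> \<open>Two sums of squares: \<open>p\<close> minus its minimum, and the nonnegative gap
    between that minimum and \<open>c\<close>.\<close>
  define \<sigma> where "\<sigma> = (p - const (peval p w)) + const (peval p w - c)"
  have "is_sos \<sigma>"
    unfolding \<sigma>_def using lb[of w]
    by (intro is_sos_add sos_convex_minus_min_is_sos is_sos_const p w) simp
  moreover have "pdeg \<sigma> \<le> 2 * d"
    unfolding \<sigma>_def p_def using assms(1,3)
    by (intro pdeg_add_le pdeg_diff_le pdeg_sum_list_le pdeg_quad_form_le) auto
  moreover have "f - const c = \<sigma> + (\<Sum>v\<leftarrow>map (\<lambda>v i. const (v i)) vs. vGv G v)"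
    by (rule peval_eqI) (simp add: \<sigma>_def p_def peval_sum_list o_def vGv_const)
  moreover have "\<forall>v\<in>set (map (\<lambda>v i. const (v i)) vs). pdeg (vGv G v) \<le> 2 * d"
    using assms(3) by (auto simp: vGv_const intro: pdeg_quad_form_le)
  ultimately show ?thesis unfolding in_QM_def by blast
qed

text \<open>Moments of the Dirac measure at \<open>x\<close>, set to 0 beyond degree
  \<open>k\<close> because \<open>mom_feasible\<close> represents truncated sequences in that
  way.\<close>

definition truncated_moments :: "nat \<Rightarrow> ('n::finite \<Rightarrow> real) \<Rightarrow> ('n \<Rightarrow>\<^sub>0 nat) \<Rightarrow> real" where
  "truncated_moments k x \<alpha> = (if \<alpha> \<in> mons k then mon x \<alpha> else 0)"

lemma Ly_truncated_moments:
  assumes "pdeg p \<le> k"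
  shows "Ly (truncated_moments k x) p = peval p x"
  unfolding peval_eq_Ly Ly_def using assms
  by (intro sum.cong) (auto simp: truncated_moments_def mons_def pdeg_le_iff in_keys_iff)

lemma pdeg_monom_le: "tdeg \<alpha> \<le> n \<Longrightarrow> pdeg (monom \<alpha>) \<le> n"
  unfolding pdeg_le_iff by (auto simp: monom_def lookup_single when_def)

lemma peval_monom [simp]: "peval (monom \<alpha>) x = mon x \<alpha>"
  by (simp add: monom_def peval_single)

text \<open>For a Dirac measure the moment matrix is the rank-one matrix of monomial values, and the
  localizing matrix is the Kronecker product of \<open>mat_eval G x\<close> with such a
  matrix.\<close>

lemma truncated_moments_feasible:
  fixes G :: "'m::finite \<Rightarrow> 'm \<Rightarrow> 'n::finite mpoly"
  assumes "mat_deg G \<le> 2 * d" "x \<in> feasible G"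
  shows "truncated_moments (2 * d) x \<in> mom_feasible d G"
proof -
  let ?y = "truncated_moments (2 * d) x"
  define s where "s = loc_order d G"
  \<comment> \<open>\<open>loc_order\<close> rounds half the degree of \<open>G\<close> up, so no
    localizing entry reaches beyond degree \<open>2 * d\<close>; the bound on
    \<open>mat_deg G\<close> keeps the natural subtraction exact.\<close>
  have s: "mat_deg G + 2 * s \<le> 2 * d"
    using assms(1) unfolding s_def loc_order_def by linarith
  have loc: "loc_mat G ?y a b = peval (G (fst a) (fst b)) x * (mon x (snd a) * mon x (snd b))"
    if "a \<in> UNIV \<times> mons s" "b \<in> UNIV \<times> mons s" for a b
  proof -
    have "tdeg (snd a + snd b) \<le> 2 * s"
      using that by (auto simp: tdeg_add mons_def)
    then have "pdeg (G (fst a) (fst b) * monom (snd a + snd b)) \<le> 2 * d"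
      using pdeg_monom_mult_le[OF pdeg_le_mat_deg, of G "fst a" "fst b" "snd a + snd b"] s by linarith
    then show ?thesis
      by (simp add: loc_mat_def Ly_truncated_moments mon_add)
  qed
  have "psd_on (UNIV \<times> mons s) (loc_mat G ?y)"
    unfolding psd_on_def
  proof
    fix c :: "'m \<times> ('n \<Rightarrow>\<^sub>0 nat) \<Rightarrow> real"
    define \<xi> where "\<xi> i = (\<Sum>\<alpha>\<in>mons s. c (i, \<alpha>) * mon x \<alpha>)" for i
    have prod: "(\<Sum>a\<in>UNIV \<times> mons s. c a * mon x (snd a) * g (fst a)) = (\<Sum>i\<in>UNIV. \<xi> i * g i)" for g
      by (simp add: \<xi>_def sum_distrib_right sum.cartesian_product split_def)
    have "(\<Sum>a\<in>UNIV \<times> mons s. \<Sum>b\<in>UNIV \<times> mons s. c a * c b * loc_mat G ?y a b) =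
        (\<Sum>a\<in>UNIV \<times> mons s. c a * mon x (snd a) *
          (\<Sum>b\<in>UNIV \<times> mons s. c b * mon x (snd b) * peval (G (fst a) (fst b)) x))"
      unfolding sum_distrib_left by (intro sum.cong refl) (simp only: loc, simp only: mult_ac)
    also have "\<dots> = (\<Sum>a\<in>UNIV \<times> mons s. c a * mon x (snd a) * (\<Sum>j\<in>UNIV. \<xi> j * peval (G (fst a) j) x))"
      by (simp only: prod[of "\<lambda>j. peval (G i j) x" for i])
    also have "\<dots> = (\<Sum>i\<in>UNIV. \<xi> i * (\<Sum>j\<in>UNIV. \<xi> j * peval (G i j) x))"
      by (rule prod)
    also have "\<dots> = peval (quad_form G \<xi>) x"
      by (simp add: peval_quad_form sum_distrib_left mult.assoc)
    finally show "0 \<le> (\<Sum>a\<in>UNIV \<times> mons s. \<Sum>b\<in>UNIV \<times> mons s. c a * c b * loc_mat G ?y a b)"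
      using assms(2) by (simp add: feasible_iff)
  qed
  moreover have "psd_on (mons d) (moment_mat ?y)"
    unfolding psd_on_def
  proof
    fix c :: "('n \<Rightarrow>\<^sub>0 nat) \<Rightarrow> real"
    have "moment_mat ?y \<alpha> \<beta> = mon x \<alpha> * mon x \<beta>" if "\<alpha> \<in> mons d" "\<beta> \<in> mons d" for \<alpha> \<beta>
    proof -
      have "tdeg (\<alpha> + \<beta>) \<le> 2 * d" using that by (auto simp: mons_def tdeg_add)
      then have "Ly ?y (monom (\<alpha> + \<beta>)) = mon x (\<alpha> + \<beta>)"
        by (subst Ly_truncated_moments) (auto intro: pdeg_monom_le)
      then show ?thesis by (simp add: moment_mat_def mon_add del: Ly_monom)
    qed
    then have "(\<Sum>\<alpha>\<in>mons d. \<Sum>\<beta>\<in>mons d. c \<alpha> * c \<beta> * moment_mat ?y \<alpha> \<beta>) =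
        (\<Sum>\<alpha>\<in>mons d. c \<alpha> * mon x \<alpha>) * (\<Sum>\<alpha>\<in>mons d. c \<alpha> * mon x \<alpha>)"
      unfolding sum_product by (intro sum.cong refl) (simp add: mult_ac)
    then show "0 \<le> (\<Sum>\<alpha>\<in>mons d. \<Sum>\<beta>\<in>mons d. c \<alpha> * c \<beta> * moment_mat ?y \<alpha> \<beta>)"
      by simp
  qed
  ultimately show ?thesis
    by (simp add: mom_feasible_def s_def truncated_moments_def)
qed

text \<open>The entries at the monomial 1 form a principal submatrix of the localizing matrix, with
  values \<open>Ly y (G i j)\<close>; the test vector \<open>c\<close> is supported there.\<close>

lemma Ly_quad_form_nonneg:
  fixes G :: "'m::finite \<Rightarrow> 'm \<Rightarrow> 'n::finite mpoly"
  assumes "y \<in> mom_feasible d G"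
  shows "0 \<le> Ly y (quad_form G \<xi>)"
proof -
  define s where "s = loc_order d G"
  define c :: "'m \<times> ('n \<Rightarrow>\<^sub>0 nat) \<Rightarrow> real" where "c = (\<lambda>(i, \<alpha>). if \<alpha> = 0 then \<xi> i else 0)"
  have sub: "(\<Sum>a\<in>UNIV \<times> mons s. c a * g a) = (\<Sum>i\<in>UNIV. \<xi> i * g (i, 0))" for g
  proof -
    have "(\<Sum>a\<in>UNIV \<times> mons s. c a * g a) = (\<Sum>i\<in>UNIV. \<Sum>\<alpha>\<in>mons s. if \<alpha> = 0 then \<xi> i * g (i, \<alpha>) else 0)"
      unfolding sum.cartesian_product by (intro sum.cong) (auto simp: c_def)
    then show ?thesis by simp
  qed
  have "0 \<le> (\<Sum>a\<in>UNIV \<times> mons s. \<Sum>b\<in>UNIV \<times> mons s. c a * c b * loc_mat G y a b)"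
    using assms unfolding mom_feasible_def psd_on_def s_def by blast
  also have "\<dots> = (\<Sum>a\<in>UNIV \<times> mons s. c a * (\<Sum>b\<in>UNIV \<times> mons s. c b * loc_mat G y a b))"
    by (simp only: sum_distrib_left mult.assoc)
  also have "\<dots> = (\<Sum>i\<in>UNIV. \<xi> i * (\<Sum>j\<in>UNIV. \<xi> j * loc_mat G y (i, 0) (j, 0)))"
    by (simp only: sub)
  also have "\<dots> = Ly y (quad_form G \<xi>)"
    by (simp add: quad_form_def Ly_sum Ly_const_mult loc_mat_def monom_def sum_distrib_left mult.assoc)
  finally show ?thesis .
qed

lemma first_moments_feasible:
  assumes "mat_deg G \<le> 2 * d" "neg_sos_convex_mat G" "y \<in> mom_feasible d G"
  shows "(\<lambda>i. y (Poly_Mapping.single i 1)) \<in> feasible G"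
  unfolding feasible_iff
proof
  fix \<xi>
  have "peval (- quad_form G \<xi>) (\<lambda>i. y (Poly_Mapping.single i 1)) \<le> Ly y (- quad_form G \<xi>)"
    using assms pdeg_quad_form_le[OF assms(1), of \<xi>]
    by (intro sos_convex_jensen[of _ d] sos_convex_uminus_quad_form) (auto simp: mom_feasible_def)
  then show "0 \<le> peval (quad_form G \<xi>) (\<lambda>i. y (Poly_Mapping.single i 1))"
    using Ly_quad_form_nonneg[OF assms(3), of \<xi>] by (simp add: Ly_uminus)
qed

theorem theorem3p5:
  fixes f :: "('n::finite) mpoly"
    and G :: "('m::finite) \<Rightarrow> 'm \<Rightarrow> 'n mpoly"
    and d :: nat
  assumes "pdeg f \<le> 2*d"
    and "symmetric_mat G"
    and "mat_deg G \<le> 2*d"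
    and "sos_convex f"
    and "neg_sos_convex_mat G"
  shows "f_mom d f G = fmin f G
     \<and> ((\<exists>u. pd_on UNIV (mat_eval G u)) \<longrightarrow> f_sos d f G = fmin f G)
     \<and> (\<forall>y. y \<in> mom_feasible d G \<and> (\<forall>z\<in>mom_feasible d G. Ly y f \<le> Ly z f) \<longrightarrow>
           (\<lambda>i. y (Poly_Mapping.single i 1)) \<in> feasible G \<and>
           (\<forall>x\<in>feasible G. peval f (\<lambda>i. y (Poly_Mapping.single i 1)) \<le> peval f x))"
proof (intro conjI impI allI)
  have jensen: "peval f (\<lambda>i. y (Poly_Mapping.single i 1)) \<le> Ly y f" if "y \<in> mom_feasible d G" for y
    using that assms by (intro sos_convex_jensen[of _ d]) (auto simp: mom_feasible_def)
  note first = first_moments_feasible[OF assms(3,5)]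
  note trunc = truncated_moments_feasible[OF assms(3)] Ly_truncated_moments[OF assms(1)]
  show "f_mom d f G = fmin f G"
  proof (rule antisym)
    show "f_mom d f G \<le> fmin f G"
      unfolding f_mom_def fmin_def
    proof (rule INF_mono)
      fix x assume "x \<in> feasible G"
      then show "\<exists>y\<in>mom_feasible d G. ereal (Ly y f) \<le> ereal (peval f x)"
        using trunc by (intro bexI[of _ "truncated_moments (2 * d) x"]) auto
    qed
    show "fmin f G \<le> f_mom d f G"
      unfolding f_mom_def fmin_def
    proof (rule INF_mono)
      fix y assume "y \<in> mom_feasible d G"
      then show "\<exists>x\<in>feasible G. ereal (peval f x) \<le> ereal (Ly y f)"
        using jensen first by (intro bexI[of _ "\<lambda>i. y (Poly_Mapping.single i 1)"]) auto
    qed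
  qed
  fix y assume y: "y \<in> mom_feasible d G \<and> (\<forall>z\<in>mom_feasible d G. Ly y f \<le> Ly z f)"
  show "(\<lambda>i. y (Poly_Mapping.single i 1)) \<in> feasible G"
    using y first by blast
  \<comment> \<open>Jensen bounds the value at the first moments by \<open>Ly y f\<close>, and
    minimality against the truncated moments of \<open>x\<close> bounds this by the value at
    \<open>x\<close>.\<close>
  show "\<forall>x\<in>feasible G. peval f (\<lambda>i. y (Poly_Mapping.single i 1)) \<le> peval f x"
    using y jensen[of y] trunc by (metis order.trans)
next
  assume "\<exists>u. pd_on UNIV (mat_eval G u)"
  then obtain u where u: "pd_on UNIV (mat_eval G u)" by blast
  show "f_sos d f G = fmin f G"
  proof (rule antisym)
    show "f_sos d f G \<le> fmin f G"
      unfolding f_sos_def fmin_def by (intro Sup_least INF_greatest) (auto dest: in_QM_imp_le)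
    \<comment> \<open>A finite value is certified as a mere lower bound, attained or not;
      \<open>\<infinity>\<close> is excluded because the Slater point is feasible, and
      \<open>- \<infinity>\<close> is trivial.\<close>
    show "fmin f G \<le> f_sos d f G"
    proof (cases "fmin f G")
      case (real c)
      have "c \<le> peval f x" if "x \<in> feasible G" for x
        using that real INF_lower[of x "feasible G" "\<lambda>x. ereal (peval f x)"] by (simp add: fmin_def)
      then have "in_QM d G (f - const c)"
        by (rule lower_bound_in_QM[OF assms u])
      then show ?thesis
        unfolding real f_sos_def by (intro Sup_upper) blast
    next
      case PInf
      then show ?thesis
        using INF_lower[OF pd_on_imp_feasible[OF u], of "\<lambda>x. ereal (peval f x)"] by (simp add: fmin_def)
    qed simp
  qed
qed

end
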